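(* Let $\Xi$ be a mapping from the simplex $\{(s,t):0\le s<t\le T\}$ to a Banach space $(E,\|\cdot\|)$ and set $\delta\Xi_{s,u,t}:=\Xi_{s,t}-\Xi_{s,u}-\Xi_{u,t}$. Assume that, for $s<u<t$, $$\|\delta\Xi_{s,u,t}\|\le\sum_{j=1}^N\omega_{1,j}^{\alpha_{1,j}}(s,u)\,\omega_{2,j}^{\alpha_{2,j}}(u,t),$$ where $\omega_{1,j},\omega_{2,j}$ are controls and $\alpha_{1,j}+\alpha_{2,j}>1$ for all $j=1,\dots,N$. Then the following limit exists uniquely in the RRS sense, $$\mathcal I\Xi_{0,T}:=\text{RRS-}\lim_{|\mathcal P|\to0}\sum_{(u,v)\in\mathcal P}\Xi_{u,v},$$ and one has the following estimate: $$\|\mathcal I\Xi_{s,t}-\Xi_{s,t}\|\le C\sum_{j=1}^N\omega_{1,j}^{\alpha_{1,j}}(s,t-)\,\omega_{2,j}^{\alpha_{2,j}}(s+,t),$$ with $C$ depending only on $\min_j\{\alpha_{1,j}+\alpha_{2,j}\}$. Furthermore, if $\omega_{1,j}(s,t)$, $j=1,\dots,N$, are left-continuous in $t$, or $\omega_{2,j}(s,t)$, $j=1,\dots,N$, are right-continuous in $s$, then the convergence holds in the MRS sense.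
   Context: A control is a function $\omega:\{0\le s\le t\le T\}\to[0,\infty)$ with $\omega(s,s)=0$ and $\omega(s,u)+\omega(u,t)\le\omega(s,t)$ for $s\le u\le t$ (no continuity assumed). $\omega(s,t-):=\lim_{r\uparrow t}\omega(s,r)$, $\omega(s+,t):=\lim_{r\downarrow s}\omega(r,t)$. Right-continuity of $\omega$ in $s$ means $\omega(s+,t)=\omega(s,t)$, and left-continuity in $t$ means $\omega(s,t-)=\omega(s,t)$, for all $0\le s<t\le T$. $\mathcal I\Xi_{s,t}$ is defined as $\mathcal I\Xi_{0,T}$, with partitions of $[s,t]$ in place of partitions of $[0,T]$. Riemann sums $\sum_{(u,v)\in\mathcal P}\Xi_{u,v}$ over partitions $\mathcal P$ of $[0,T]$ converge to $K$ in the RRS (refinement Riemann–Stieltjes) sense if for every $\varepsilon>0$ there is a partition $\mathcal P_\varepsilon$ such that $\|\sum_{(u,v)\in\mathcal P}\Xi_{u,v}-K\|<\varepsilon$ for every refinement $\mathcal P\supset\mathcal P_\varepsilon$; in the MRS (mesh Riemann–Stieltjes) sense if for every $\varepsilon>0$ there is $\delta>0$ such that this inequality holds for every $\mathcal P$ with mesh $|\mathcal P|<\delta$.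
   Formalization: The constant C may depend on the number N of summands as well as on min_j{α_{1,j}+α_{2,j}} (no C independent of N exists), and all exponents α_{1,j}, α_{2,j} are assumed positive (the claim fails for α_{1,j}=0); C is stated for each Banach space E. *)

theory Defs
  imports "HOL-Analysis.Analysis"
begin

text \<open>
  Functions on the simplex of pairs \<open>0 \<le> s \<le> t \<le> T\<close> are total functions of two real arguments;
  nothing is assumed or used about their values outside the simplex.
\<close>

definition control :: "real \<Rightarrow> (real \<Rightarrow> real \<Rightarrow> real) \<Rightarrow> bool" where
  "control T \<omega> \<longleftrightarrow>
     (\<forall>s t. 0 \<le> s \<and> s \<le> t \<and> t \<le> T \<longrightarrow> 0 \<le> \<omega> s t) \<and>
     (\<forall>s. 0 \<le> s \<and> s \<le> T \<longrightarrow> \<omega> s s = 0) \<and>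
     (\<forall>s u t. 0 \<le> s \<and> s \<le> u \<and> u \<le> t \<and> t \<le> T \<longrightarrow> \<omega> s u + \<omega> u t \<le> \<omega> s t)"

text \<open>
  The one-sided limits \<open>\<omega>(s,t-)\<close> and \<open>\<omega>(s+,t)\<close>. For a control and \<open>0 \<le> s < t \<le> T\<close> both exist,
  because a control is nonnegative and monotone under inclusion of intervals.
\<close>

definition left_lim :: "(real \<Rightarrow> real \<Rightarrow> real) \<Rightarrow> real \<Rightarrow> real \<Rightarrow> real" where
  "left_lim \<omega> s t = Lim (at_left t) (\<lambda>r. \<omega> s r)"

definition right_lim :: "(real \<Rightarrow> real \<Rightarrow> real) \<Rightarrow> real \<Rightarrow> real \<Rightarrow> real" where
  "right_lim \<omega> s t = Lim (at_right s) (\<lambda>r. \<omega> r t)"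

definition left_continuous_snd :: "real \<Rightarrow> (real \<Rightarrow> real \<Rightarrow> real) \<Rightarrow> bool" where
  "left_continuous_snd T \<omega> \<longleftrightarrow> (\<forall>s t. 0 \<le> s \<and> s < t \<and> t \<le> T \<longrightarrow> left_lim \<omega> s t = \<omega> s t)"

definition right_continuous_fst :: "real \<Rightarrow> (real \<Rightarrow> real \<Rightarrow> real) \<Rightarrow> bool" where
  "right_continuous_fst T \<omega> \<longleftrightarrow> (\<forall>s t. 0 \<le> s \<and> s < t \<and> t \<le> T \<longrightarrow> right_lim \<omega> s t = \<omega> s t)"

text \<open>
  A partition of \<open>[s,t]\<close> is represented by its finite set of division points, endpoints included,
  so that refinement is inclusion; \<open>(u,v) \<in> \<P>\<close> becomes membership in \<open>partition_intervals P\<close>.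
\<close>

definition is_partition :: "real \<Rightarrow> real \<Rightarrow> real set \<Rightarrow> bool" where
  "is_partition s t P \<longleftrightarrow> finite P \<and> s \<in> P \<and> t \<in> P \<and> P \<subseteq> {s..t}"

definition partition_intervals :: "real set \<Rightarrow> (real \<times> real) set" where
  "partition_intervals P = {(u, v). u \<in> P \<and> v \<in> P \<and> u < v \<and> {u<..<v} \<inter> P = {}}"

definition mesh :: "real set \<Rightarrow> real" where
  "mesh P = Max ((\<lambda>(u, v). v - u) ` partition_intervals P)"

definition riemann_sum :: "(real \<Rightarrow> real \<Rightarrow> 'a::real_normed_vector) \<Rightarrow> real set \<Rightarrow> 'a" where
  "riemann_sum \<Xi> P = (\<Sum>(u, v)\<in>partition_intervals P. \<Xi> u v)"

definition RRS_converges ::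
  "(real \<Rightarrow> real \<Rightarrow> 'a::real_normed_vector) \<Rightarrow> real \<Rightarrow> real \<Rightarrow> 'a \<Rightarrow> bool" where
  "RRS_converges \<Xi> s t K \<longleftrightarrow>
     (\<forall>\<epsilon>>0. \<exists>P\<^sub>\<epsilon>. is_partition s t P\<^sub>\<epsilon> \<and>
        (\<forall>P. is_partition s t P \<and> P\<^sub>\<epsilon> \<subseteq> P \<longrightarrow> norm (riemann_sum \<Xi> P - K) < \<epsilon>))"

definition MRS_converges ::
  "(real \<Rightarrow> real \<Rightarrow> 'a::real_normed_vector) \<Rightarrow> real \<Rightarrow> real \<Rightarrow> 'a \<Rightarrow> bool" where
  "MRS_converges \<Xi> s t K \<longleftrightarrow>
     (\<forall>\<epsilon>>0. \<exists>\<delta>>0. \<forall>P. is_partition s t P \<and> mesh P < \<delta> \<longrightarrow> norm (riemann_sum \<Xi> P - K) < \<epsilon>)"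

text \<open>Meaningful only where the limit in the RRS sense exists uniquely.\<close>

definition sewing_integral ::
  "(real \<Rightarrow> real \<Rightarrow> 'a::real_normed_vector) \<Rightarrow> real \<Rightarrow> real \<Rightarrow> 'a" where
  "sewing_integral \<Xi> s t = (THE K. RRS_converges \<Xi> s t K)"

definition delta :: "(real \<Rightarrow> real \<Rightarrow> 'a::real_normed_vector) \<Rightarrow> real \<Rightarrow> real \<Rightarrow> real \<Rightarrow> 'a" where
  "delta \<Xi> s u t = \<Xi> s t - \<Xi> s u - \<Xi> u t"

end

theory Submission
  imports Defs
begin

text \<open>
  Write \<open>\<theta>\<close> for the least of the sums \<open>\<alpha>1 j + \<alpha>2 j\<close>. The first ingredient is Young's argument:
  remove the interior points of a partition of \<open>[s,t]\<close> one after the other, each time a point that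
  is cheap to remove. Removing \<open>x\<close> with neighbours \<open>u < x < v\<close> changes the Riemann sum by
  \<open>delta \<Xi> u x v\<close>. The intervals to the left of interior points all avoid \<open>t\<close>, those to the right all
  avoid \<open>s\<close>, so superadditivity and Hoelder's inequality bound the sum over the interior points of
  \<open>\<omega>1(u,x) powr \<beta>1 * \<omega>2(x,v) powr \<beta>2\<close>, where \<open>\<beta>1 + \<beta>2 = 1\<close> are the normalised exponents, by
  \<open>\<omega>1(s,t-) powr \<beta>1 * \<omega>2(s+,t) powr \<beta>2\<close>. By the pigeonhole principle some one of the \<open>m\<close> interior
  points costs at most \<open>(N / m) powr \<theta>\<close> times the sum over \<open>j\<close> in the claimed estimate. Since
  \<open>\<theta> > 1\<close>, these costs are summable over \<open>m\<close>, which gives a bound on \<open>riemann_sum \<Xi> P - \<Xi> s t\<close> that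
  is uniform in \<open>P\<close> (\<open>riemann_sum_minus_le\<close>).

  For convergence under refinement this bound is applied on every interval \<open>(u,v)\<close> of a partition
  \<open>Q\<close>, and the resulting errors are summed. With
  \<open>\<phi>(u,v) = \<omega>1(u,v-) powr \<beta>1 * \<omega>2(u+,v) powr \<beta>2\<close>, the error on \<open>(u,v)\<close> is at most a
  constant times a sum over \<open>j\<close> of powers of \<open>\<phi>(u,v)\<close> with exponents greater than \<open>1\<close>, while the sum
  of \<open>\<phi>\<close> over the intervals of \<open>Q\<close> is bounded independently of \<open>Q\<close>. It is therefore enough that \<open>Q\<close> can be chosen with \<open>\<phi>\<close> uniformly small. Jumps of the controls do not
  prevent this, because \<open>\<omega>1(u,v-)\<close> leaves out a jump at \<open>v\<close> and \<open>\<omega>2(u+,v)\<close> a jump at \<open>u\<close>: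
  \<open>\<omega>1(u,x-)\<close> tends to \<open>0\<close> as \<open>u\<close> increases to \<open>x\<close>, and \<open>\<omega>2(x+,v)\<close> tends to \<open>0\<close> as \<open>v\<close> decreases to
  \<open>x\<close>. Every point thus has a neighbourhood in which the intervals that begin or end at that point
  are good, and by compactness (\<open>partition_into_good_intervals\<close>) some partition consists of good
  intervals only.

  Convergence under refinement yields convergence as the mesh vanishes as soon as
  \<open>delta \<Xi> u x v\<close> tends to \<open>0\<close> when \<open>u\<close> and \<open>v\<close> approach \<open>x\<close> from the two sides: a partition \<open>P\<close> of
  small mesh is compared with \<open>P \<union> Q\<close>, where \<open>Q\<close> is a fixed partition beyond which the Riemann sums
  are close to the limit, and only the finitely many points of \<open>Q\<close> have to be inserted into \<open>P\<close>
  (\<open>MRS_converges_if_RRS_converges\<close>). Either of the two continuity assumptions makes one of the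
  factors that bound \<open>delta \<Xi> u x v\<close> vanish in the limit.
\<close>

section \<open>Partitions as finite sets of division points\<close>

lemma partition_intervals_iff:
  "(u, v) \<in> partition_intervals P \<longleftrightarrow> u \<in> P \<and> v \<in> P \<and> u < v \<and> {u<..<v} \<inter> P = {}"
  by (simp add: partition_intervals_def)

lemma finite_partition_intervals [simp]: "finite P \<Longrightarrow> finite (partition_intervals P)"
  by (rule finite_subset[of _ "P \<times> P"]) (auto simp: partition_intervals_def)

lemma is_partition_Un:
  "is_partition s t P \<Longrightarrow> is_partition s t Q \<Longrightarrow> is_partition s t (P \<union> Q)"
  by (auto simp: is_partition_def)

lemma is_partition_restrict:
  assumes "is_partition s t P" "Q \<subseteq> P" "(u, v) \<in> partition_intervals Q"
  shows "is_partition u v (P \<inter> {u..v})"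
  using assms by (auto simp: is_partition_def partition_intervals_iff)

lemma enclosing_interval:
  assumes "finite P" "x \<notin> P" "p \<in> P" "p < x" "q \<in> P" "x < q"
  obtains u v where "(u, v) \<in> partition_intervals P" "u < x" "x < v"
proof -
  define u where "u = Max {p\<in>P. p < x}"
  define v where "v = Min {p\<in>P. x < p}"
  have u: "u \<in> {p\<in>P. p < x}" unfolding u_def using assms by (intro Max_in) auto
  have v: "v \<in> {p\<in>P. x < p}" unfolding v_def using assms by (intro Min_in) auto
  have u': "y \<le> u" if "y \<in> P" "y < x" for y
    unfolding u_def using assms that by (intro Max_ge) auto
  have v': "v \<le> y" if "y \<in> P" "x < y" for y
    unfolding v_def using assms that by (intro Min_le) auto
  have "{u<..<v} \<inter> P = {}"
    using u' v' assms(2) by (metis (no_types, lifting) disjoint_iff greaterThanLessThan_iff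
        linorder_neqE_linordered_idom not_less)
  with u v that show thesis by (force simp: partition_intervals_iff)
qed

lemma partition_intervals_insert:
  assumes "(u, v) \<in> partition_intervals P" "u < x" "x < v"
  shows "partition_intervals (insert x P) =
           insert (u, x) (insert (x, v) (partition_intervals P - {(u, v)}))"
proof -
  have uv: "u \<in> P" "v \<in> P" "{u<..<v} \<inter> P = {}"
    using assms by (auto simp: partition_intervals_iff)
  then have gap: "y \<le> u \<or> v \<le> y" if "y \<in> P" for y
    using that by (meson disjoint_iff greaterThanLessThan_iff not_le)
  have "(a, b) \<in> partition_intervals (insert x P) \<longleftrightarrow>
        (a, b) \<in> insert (u, x) (insert (x, v) (partition_intervals P - {(u, v)}))" for a b
  proof -
    consider "a = x" | "b = x" "a \<noteq> x" | "a \<noteq> x" "b \<noteq> x" by blast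
    then show ?thesis
    proof cases
      case 1
      have "x \<notin> P" using gap[of x] assms by force
      have "b = v" if "b \<in> P" "x < b" "{x<..<b} \<inter> insert x P = {}"
        using gap[of b] that uv assms by force
      moreover have "{x<..<v} \<inter> insert x P = {}" using gap assms by force
      ultimately show ?thesis using 1 assms uv \<open>x \<notin> P\<close>
        by (auto simp: partition_intervals_iff)
    next
      case 2
      have "x \<notin> P" using gap[of x] assms by force
      have "a = u" if "a \<in> P" "a < x" "{a<..<x} \<inter> insert x P = {}"
        using gap[of a] that uv assms by force
      moreover have "{u<..<x} \<inter> insert x P = {}" using gap assms by force
      ultimately show ?thesis using 2 assms uv \<open>x \<notin> P\<close>
        by (auto simp: partition_intervals_iff)
    next
      case 3
      have "a < x \<and> x < b \<longleftrightarrow> a = u \<and> b = v" if "a \<in> P" "b \<in> P" "a < b" "{a<..<b} \<inter> P = {}"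
      proof -
        have "\<not> (a < u \<and> u < b)" "\<not> (a < v \<and> v < b)" using that uv by auto
        then show ?thesis using gap[OF that(1)] gap[OF that(2)] that(3) assms(2,3) by auto
      qed
      then show ?thesis using 3 assms uv
        by (auto simp: partition_intervals_iff)
    qed
  qed
  then show ?thesis by (intro set_eqI) (metis surj_pair)
qed

lemma riemann_sum_insert:
  assumes "finite P" "(u, v) \<in> partition_intervals P" "u < x" "x < v"
  shows "riemann_sum \<Xi> (insert x P) = riemann_sum \<Xi> P - delta \<Xi> u x v"
proof -
  have "x \<notin> P" using assms by (auto simp: partition_intervals_iff)
  then have new: "(u, x) \<notin> partition_intervals P" "(x, v) \<notin> partition_intervals P"
    by (auto simp: partition_intervals_iff)
  have "riemann_sum \<Xi> (insert x P) =
          \<Xi> u x + (\<Xi> x v + (\<Sum>(a, b)\<in>partition_intervals P - {(u, v)}. \<Xi> a b))"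
    unfolding riemann_sum_def partition_intervals_insert[OF assms(2-4)]
    using assms new by simp
  also have "(\<Sum>(a, b)\<in>partition_intervals P - {(u, v)}. \<Xi> a b) = riemann_sum \<Xi> P - \<Xi> u v"
    unfolding riemann_sum_def using assms by (simp add: sum_diff1)
  finally show ?thesis by (simp add: delta_def)
qed

lemma partition_intervals_insert_greater:
  assumes "finite P" "P \<noteq> {}" "\<forall>a\<in>P. a < b"
  shows "partition_intervals (insert b P) = insert (Max P, b) (partition_intervals P)"
proof -
  have M: "Max P \<in> P" and ge: "\<And>a. a \<in> P \<Longrightarrow> a \<le> Max P" using assms by auto
  have "(u, v) \<in> partition_intervals (insert b P) \<longleftrightarrow>
        (u, v) \<in> insert (Max P, b) (partition_intervals P)" for u v
  proof (cases "v = b")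
    case True
    have "u = Max P" if "u \<in> P" "{u<..<b} \<inter> insert b P = {}"
      using that ge[of u] M assms(3) by force
    then show ?thesis using True M assms(3) ge by (force simp: partition_intervals_iff)
  next
    case False
    then show ?thesis using assms(3) by (force simp: partition_intervals_iff)
  qed
  then show ?thesis by (intro set_eqI) (metis surj_pair)
qed

lemma coarser_interval:
  assumes "is_partition s t P" "is_partition s t Q" "Q \<subseteq> P" "(a, b) \<in> partition_intervals P"
  obtains u v where "(u, v) \<in> partition_intervals Q" "u \<le> a" "b \<le> v"
proof -
  have fin: "finite Q" using assms by (auto simp: is_partition_def)
  define u where "u = Max {q\<in>Q. q \<le> a}"
  define v where "v = Min {q\<in>Q. b \<le> q}"
  have st: "s \<in> Q" "t \<in> Q" "s \<le> a" "b \<le> t"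
    using assms by (auto simp: is_partition_def partition_intervals_iff)
  have u: "u \<in> {q\<in>Q. q \<le> a}" unfolding u_def using fin st by (intro Max_in) auto
  have v: "v \<in> {q\<in>Q. b \<le> q}" unfolding v_def using fin st by (intro Min_in) auto
  have u': "y \<le> u" if "y \<in> Q" "y \<le> a" for y
    unfolding u_def using fin that by (intro Max_ge) auto
  have v': "v \<le> y" if "y \<in> Q" "b \<le> y" for y
    unfolding v_def using fin that by (intro Min_le) auto
  have ab: "a < b" "{a<..<b} \<inter> P = {}"
    using assms by (auto simp: partition_intervals_iff)
  then have "y \<le> a \<or> b \<le> y" if "y \<in> Q" for y
    using that assms(3) by (meson disjoint_iff greaterThanLessThan_iff linorder_not_less subsetD)
  then have "{u<..<v} \<inter> Q = {}" using u' v' by force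
  then have "(u, v) \<in> partition_intervals Q" using u v ab by (auto simp: partition_intervals_iff)
  with u v that show thesis by auto
qed

text \<open>
  This reduces the comparison of a partition \<open>Q\<close> with a refinement to single intervals of \<open>Q\<close>, where
  the error committed by \<open>\<Xi>\<close> can be estimated separately.
\<close>

lemma riemann_sum_refinement:
  assumes "is_partition s t P" "is_partition s t Q" "Q \<subseteq> P"
  shows "riemann_sum \<Xi> P = (\<Sum>(u, v)\<in>partition_intervals Q. riemann_sum \<Xi> (P \<inter> {u..v}))"
proof -
  define I where "I = (\<lambda>(u, v). partition_intervals (P \<inter> {u..v :: real}))"
  have fin: "finite P" "finite Q" using assms by (auto simp: is_partition_def)
  have sub: "(a, b) \<in> \<Union> (I ` partition_intervals Q)" if ab: "(a, b) \<in> partition_intervals P" for a b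
  proof -
    obtain u v where "(u, v) \<in> partition_intervals Q" "u \<le> a" "b \<le> v"
      using coarser_interval[OF assms ab] .
    moreover from this have "(a, b) \<in> I (u, v)"
      using ab by (auto simp: I_def partition_intervals_iff)
    ultimately show ?thesis by blast
  qed
  have sup: "(a, b) \<in> partition_intervals P"
    if "(u, v) \<in> partition_intervals Q" "(a, b) \<in> I (u, v)" for u v a b
    using that by (auto simp: I_def partition_intervals_iff disjoint_iff)
  have union: "partition_intervals P = \<Union> (I ` partition_intervals Q)"
    using sub sup by (intro set_eqI) (metis (no_types, lifting) UN_E surj_pair)
  have disj: "I i \<inter> I j = {}"
    if "i \<in> partition_intervals Q" "j \<in> partition_intervals Q" "i \<noteq> j" for i j
  proof -
    obtain u v u' v' where ij: "i = (u, v)" "j = (u', v')" by (metis surj_pair)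
    have Q: "u \<in> Q" "v \<in> Q" "u' \<in> Q" "v' \<in> Q" "u < v" "u' < v'"
      using that by (auto simp: ij partition_intervals_iff)
    have gap: "y \<le> u \<or> v \<le> y" "y \<le> u' \<or> v' \<le> y" if "y \<in> Q" for y
      using \<open>i \<in> partition_intervals Q\<close> \<open>j \<in> partition_intervals Q\<close> that
      by (force simp: ij partition_intervals_iff)+
    have "v \<le> u' \<or> v' \<le> u"
    proof (rule ccontr)
      assume "\<not> ?thesis"
      then have "u' < v" "u < v'" by auto
      then have "u' = u" using gap(1)[of u'] gap(2)[of u] Q by linarith
      moreover have "v' = v"
        using gap(1)[of v'] gap(2)[of v] Q \<open>u' < v\<close> \<open>u < v'\<close> by linarith
      ultimately show False using that ij by simp
    qed
    then show ?thesis by (auto simp: ij I_def partition_intervals_iff)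
  qed
  have "riemann_sum \<Xi> P = (\<Sum>i\<in>partition_intervals Q. \<Sum>(u, v)\<in>I i. \<Xi> u v)"
    unfolding riemann_sum_def union using fin disj
    by (intro sum.UNION_disjoint) (auto simp: I_def)
  then show ?thesis by (simp add: riemann_sum_def I_def split_def)
qed

text \<open>
  A tagged form of compactness. Bisection needs short intervals around \<open>x\<close> to be partitionable into
  good ones, and cutting such an interval at \<open>x\<close> reduces this to intervals with endpoint \<open>x\<close>. With
  jumps at \<open>x\<close>, an interval with \<open>x\<close> in its interior can be bad however short it is.
\<close>

lemma partition_into_good_intervals:
  fixes G :: "real \<Rightarrow> real \<Rightarrow> bool"
  assumes "s \<le> t"
    and loc: "\<And>x. s \<le> x \<Longrightarrow> x \<le> t \<Longrightarrow> \<exists>d>0.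
      (\<forall>u. s \<le> u \<and> u < x \<and> x - u < d \<longrightarrow> G u x) \<and> (\<forall>v. x < v \<and> v \<le> t \<and> v - x < d \<longrightarrow> G x v)"
  obtains Q where "is_partition s t Q" "\<forall>(u, v)\<in>partition_intervals Q. G u v"
proof -
  define covered where "covered = (\<lambda>a b. s \<le> a \<longrightarrow> b \<le> t \<longrightarrow> a \<le> b \<longrightarrow>
     (\<exists>Q. is_partition a b Q \<and> (\<forall>(u, v)\<in>partition_intervals Q. G u v)))"
  from \<open>s \<le> t\<close> have "covered s t"
  proof (induction rule: Bolzano)
    case (trans a b c)
    show ?case unfolding covered_def
    proof (intro impI)
      assume "s \<le> a" "c \<le> t" "a \<le> c"
      with trans obtain Q R where Q: "is_partition a b Q" "\<forall>(u, v)\<in>partition_intervals Q. G u v"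
        and R: "is_partition b c R" "\<forall>(u, v)\<in>partition_intervals R. G u v"
        unfolding covered_def by (metis order_trans)
      have "partition_intervals (Q \<union> R) \<subseteq> partition_intervals Q \<union> partition_intervals R"
      proof clarify
        fix u v
        assume uv: "(u, v) \<in> partition_intervals (Q \<union> R)" "(u, v) \<notin> partition_intervals R"
        have b: "b \<in> Q" "b \<in> R" "Q \<subseteq> {..b}" "R \<subseteq> {b..}"
          using Q(1) R(1) by (auto simp: is_partition_def)
        have "v \<le> b \<or> b \<le> u"
          using uv(1) b(1)
          by (metis UnI1 disjoint_iff greaterThanLessThan_iff not_le partition_intervals_iff)
        then show "(u, v) \<in> partition_intervals Q"
        proof
          assume "v \<le> b"
          then have "u \<in> Q" "v \<in> Q"
            using uv(1) b by (auto simp: partition_intervals_iff dest: order_antisym)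
          then show ?thesis using uv(1) by (auto simp: partition_intervals_iff)
        next
          assume "b \<le> u"
          then have "u \<in> R" "v \<in> R"
            using uv(1) b by (auto simp: partition_intervals_iff dest: order_antisym)
          then show ?thesis using uv by (auto simp: partition_intervals_iff)
        qed
      qed
      moreover have "is_partition a c (Q \<union> R)"
        using Q(1) R(1) trans by (force simp: is_partition_def)
      ultimately show "\<exists>Q. is_partition a c Q \<and> (\<forall>(u, v)\<in>partition_intervals Q. G u v)"
        using Q(2) R(2) by blast
    qed
  next
    case (local x)
    then obtain d where "d > 0" and d: "\<And>u. s \<le> u \<Longrightarrow> u < x \<Longrightarrow> x - u < d \<Longrightarrow> G u x"
      "\<And>v. x < v \<Longrightarrow> v \<le> t \<Longrightarrow> v - x < d \<Longrightarrow> G x v" using loc by meson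
    have "covered a b" if ab: "a \<le> x" "x \<le> b" "b - a < d" for a b
      unfolding covered_def
    proof (intro impI exI conjI)
      assume *: "s \<le> a" "b \<le> t" "a \<le> b"
      show "is_partition a b {a, x, b}" using ab by (auto simp: is_partition_def)
      have "G u v" if uv: "(u, v) \<in> partition_intervals {a, x, b}" for u v
      proof -
        have "u < v" "(u = a \<and> v = x) \<or> (u = x \<and> v = b)"
          using uv ab by (auto simp: partition_intervals_iff)
        then show ?thesis using d(1)[of u] d(2)[of v] * ab by auto
      qed
      then show "\<forall>(u, v)\<in>partition_intervals {a, x, b}. G u v" by blast
    qed
    with \<open>d > 0\<close> show ?case by blast
  qed
  with assms(1) that show thesis unfolding covered_def by auto
qed

section \<open>Controls and their one-sided limits\<close>

lemma control_nonneg: "control T \<omega> \<Longrightarrow> 0 \<le> s \<Longrightarrow> s \<le> t \<Longrightarrow> t \<le> T \<Longrightarrow> 0 \<le> \<omega> s t"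
  by (simp add: control_def)

lemma control_superadditive:
  "control T \<omega> \<Longrightarrow> 0 \<le> s \<Longrightarrow> s \<le> u \<Longrightarrow> u \<le> t \<Longrightarrow> t \<le> T \<Longrightarrow> \<omega> s u + \<omega> u t \<le> \<omega> s t"
  by (simp add: control_def)

lemma control_mono:
  assumes "control T \<omega>" "0 \<le> s" "s \<le> u" "u \<le> v" "v \<le> t" "t \<le> T"
  shows "\<omega> u v \<le> \<omega> s t"
  using control_superadditive[OF assms(1), of s u t] control_superadditive[OF assms(1), of u v t]
    control_nonneg[OF assms(1), of s u] control_nonneg[OF assms(1), of v t] assms by linarith

text \<open>
  Superadditivity, iterated over the intervals of an arbitrary finite set of points, not necessarily
  containing \<open>s\<close> and \<open>t\<close>: Young's argument needs it for a partition without one of its endpoints.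
\<close>

lemma control_sum_le:
  assumes "control T \<omega>" "finite P" "P \<noteq> {}" "P \<subseteq> {s..t}" "0 \<le> s" "t \<le> T"
  shows "(\<Sum>(u, v)\<in>partition_intervals P. \<omega> u v) \<le> \<omega> s t"
proof -
  have "P \<noteq> {} \<longrightarrow> P \<subseteq> {s..t} \<longrightarrow> (\<Sum>(u, v)\<in>partition_intervals P. \<omega> u v) \<le> \<omega> s (Max P)"
    using assms(2)
  proof (induction rule: finite_linorder_max_induct)
    case empty
    then show ?case by simp
  next
    case (insert b P)
    show ?case
    proof (intro impI)
      assume *: "insert b P \<noteq> {}" "insert b P \<subseteq> {s..t}"
      show "(\<Sum>(u, v)\<in>partition_intervals (insert b P). \<omega> u v) \<le> \<omega> s (Max (insert b P))"
      proof (cases "P = {}")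
        case True
        have "partition_intervals {b} = {}" by (auto simp: partition_intervals_def)
        then show ?thesis using True control_nonneg[OF assms(1), of s b] * assms by auto
      next
        case False
        have M: "Max P \<in> P" using insert False by simp
        then have M': "s \<le> Max P" "Max P \<le> b" "b \<le> t" using insert(2) * by auto
        have "(Max P, b) \<notin> partition_intervals P"
          using insert by (auto simp: partition_intervals_iff)
        then have "(\<Sum>(u, v)\<in>partition_intervals (insert b P). \<omega> u v)
            = \<omega> (Max P) b + (\<Sum>(u, v)\<in>partition_intervals P. \<omega> u v)"
          using insert False by (simp add: partition_intervals_insert_greater)
        also have "\<dots> \<le> \<omega> (Max P) b + \<omega> s (Max P)" using insert * False by auto
        also have "\<dots> \<le> \<omega> s b"
          using control_superadditive[OF assms(1), of s "Max P" b] M' assms by auto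
        finally have "(\<Sum>(u, v)\<in>partition_intervals (insert b P). \<omega> u v) \<le> \<omega> s b" .
        moreover have "Max (insert b P) = b"
          using insert by (intro Max_eqI) auto
        ultimately show ?thesis by simp
      qed
    qed
  qed
  then have "(\<Sum>(u, v)\<in>partition_intervals P. \<omega> u v) \<le> \<omega> s (Max P)" using assms by simp
  also have "Max P \<in> {s..t}" using Max_in[OF assms(2,3)] assms(4) by blast
  then have "\<omega> s (Max P) \<le> \<omega> s t" using assms by (intro control_mono[OF assms(1)]) auto
  finally show ?thesis .
qed

text \<open>
  Controls increase with the interval, so the one-sided limits exist. This is what gives the values
  \<open>left_lim\<close> and \<open>right_lim\<close> their meaning.
\<close>

lemma left_lim_tendsto:
  assumes "control T \<omega>" "0 \<le> s" "s < t" "t \<le> T"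
  shows "((\<lambda>r. \<omega> s r) \<longlongrightarrow> left_lim \<omega> s t) (at_left t)"
proof -
  have "((\<lambda>r. \<omega> s r) \<longlongrightarrow> Sup (\<omega> s ` ({..<t} \<inter> {s<..}))) (at t within ({..<t} \<inter> {s<..}))"
    using assms by (intro Lim_left_bound[where K = "\<omega> s t"] control_mono[OF assms(1)]) auto
  moreover have "at t within ({..<t} \<inter> {s<..}) = at_left t"
    using assms by (intro at_within_nhd[of _ "{s<..}"]) auto
  ultimately show ?thesis unfolding left_lim_def
    using tendsto_Lim by (metis trivial_limit_at_left_real)
qed

lemma right_lim_tendsto:
  assumes "control T \<omega>" "0 \<le> s" "s < t" "t \<le> T"
  shows "((\<lambda>r. \<omega> r t) \<longlongrightarrow> right_lim \<omega> s t) (at_right s)"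
proof -
  have "((\<lambda>r. - \<omega> r t) \<longlongrightarrow> Inf ((\<lambda>r. - \<omega> r t) ` ({s<..} \<inter> {..<t}))) (at s within ({s<..} \<inter> {..<t}))"
    using assms by (intro Lim_right_bound[where K = "- \<omega> s t"])
      (auto intro!: control_mono[OF assms(1)])
  moreover have "at s within ({s<..} \<inter> {..<t}) = at_right s"
    using assms by (intro at_within_nhd[of _ "{..<t}"]) auto
  ultimately have "((\<lambda>r. \<omega> r t) \<longlongrightarrow> - Inf ((\<lambda>r. - \<omega> r t) ` ({s<..} \<inter> {..<t}))) (at_right s)"
    using tendsto_minus_cancel_left by fastforce
  then show ?thesis unfolding right_lim_def
    using tendsto_Lim by (metis trivial_limit_at_right_real)
qed

lemma left_lim_ge:
  assumes "control T \<omega>" "0 \<le> s" "s \<le> r" "r < t" "t \<le> T"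
  shows "\<omega> s r \<le> left_lim \<omega> s t"
proof (rule tendsto_lowerbound[OF left_lim_tendsto])
  show "\<forall>\<^sub>F q in at_left t. \<omega> s r \<le> \<omega> s q"
    using eventually_at_left_real[OF assms(4)]
    by eventually_elim (use assms in \<open>auto intro!: control_mono[OF assms(1)]\<close>)
qed (use assms in auto)

lemma left_lim_le:
  assumes "control T \<omega>" "0 \<le> s" "s < t" "t \<le> T" "\<And>r. s < r \<Longrightarrow> r < t \<Longrightarrow> \<omega> s r \<le> M"
  shows "left_lim \<omega> s t \<le> M"
proof (rule tendsto_upperbound[OF left_lim_tendsto])
  show "\<forall>\<^sub>F q in at_left t. \<omega> s q \<le> M"
    using eventually_at_left_real[OF assms(3)] by eventually_elim (use assms in auto)
qed (use assms in auto)

lemma right_lim_ge: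
  assumes "control T \<omega>" "0 \<le> s" "s < r" "r \<le> t" "t \<le> T"
  shows "\<omega> r t \<le> right_lim \<omega> s t"
proof (rule tendsto_lowerbound[OF right_lim_tendsto])
  show "\<forall>\<^sub>F q in at_right s. \<omega> r t \<le> \<omega> q t"
    using eventually_at_right_real[OF assms(3)]
    by eventually_elim (use assms in \<open>auto intro!: control_mono[OF assms(1)]\<close>)
qed (use assms in auto)

lemma right_lim_le:
  assumes "control T \<omega>" "0 \<le> s" "s < t" "t \<le> T" "\<And>r. s < r \<Longrightarrow> r < t \<Longrightarrow> \<omega> r t \<le> M"
  shows "right_lim \<omega> s t \<le> M"
proof (rule tendsto_upperbound[OF right_lim_tendsto])
  show "\<forall>\<^sub>F q in at_right s. \<omega> q t \<le> M"
    using eventually_at_right_real[OF assms(3)] by eventually_elim (use assms in auto)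
qed (use assms in auto)

lemma left_lim_nonneg:
  assumes "control T \<omega>" "0 \<le> s" "s < t" "t \<le> T"
  shows "0 \<le> left_lim \<omega> s t"
  using left_lim_ge[OF assms(1,2), of s t] control_nonneg[OF assms(1), of s s] assms by simp

lemma right_lim_nonneg:
  assumes "control T \<omega>" "0 \<le> s" "s < t" "t \<le> T"
  shows "0 \<le> right_lim \<omega> s t"
  using right_lim_ge[OF assms(1,2), of t t] control_nonneg[OF assms(1), of t t] assms by simp

lemma left_lim_le_control:
  assumes "control T \<omega>" "0 \<le> s" "s < t" "t \<le> T"
  shows "left_lim \<omega> s t \<le> \<omega> s t"
  using assms by (intro left_lim_le[OF assms] control_mono[OF assms(1)]) auto

lemma right_lim_le_control:
  assumes "control T \<omega>" "0 \<le> s" "s < t" "t \<le> T"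
  shows "right_lim \<omega> s t \<le> \<omega> s t"
  using assms by (intro right_lim_le[OF assms] control_mono[OF assms(1)]) auto

text \<open>
  Excluding the right endpoint removes a possible jump there: by superadditivity \<open>left_lim \<omega> u x\<close> is
  at most the increment from \<open>u\<close> to the left limit at \<open>x\<close> of the increasing function \<open>\<omega> s\<close>, and this
  increment vanishes as \<open>u\<close> approaches \<open>x\<close>. The same may fail for \<open>\<omega> u x\<close> itself.
\<close>

lemma left_lim_tendsto_0:
  assumes "control T \<omega>" "0 \<le> s" "s < x" "x \<le> T"
  shows "((\<lambda>u. left_lim \<omega> u x) \<longlongrightarrow> 0) (at_left x)"
proof (rule tendsto_sandwich)
  have "left_lim \<omega> u x \<le> left_lim \<omega> s x - \<omega> s u" if u: "s < u" "u < x" for u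
  proof (rule left_lim_le[OF assms(1)])
    fix r assume "u < r" "r < x"
    then show "\<omega> u r \<le> left_lim \<omega> s x - \<omega> s u"
      using control_superadditive[OF assms(1), of s u r] left_lim_ge[OF assms(1), of s r x] u assms
      by auto
  qed (use u assms in auto)
  then show "\<forall>\<^sub>F u in at_left x. left_lim \<omega> u x \<le> left_lim \<omega> s x - \<omega> s u"
    using eventually_at_left_real[OF assms(3)] by (auto elim!: eventually_mono)
  show "\<forall>\<^sub>F u in at_left x. 0 \<le> left_lim \<omega> u x"
    using eventually_at_left_real[OF assms(3)]
    by eventually_elim (use assms in \<open>auto intro: left_lim_nonneg\<close>)
  show "((\<lambda>u. left_lim \<omega> s x - \<omega> s u) \<longlongrightarrow> 0) (at_left x)"
    using tendsto_diff[OF tendsto_const left_lim_tendsto[OF assms], of "left_lim \<omega> s x"] by simp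
qed simp

lemma right_lim_tendsto_0:
  assumes "control T \<omega>" "0 \<le> x" "x < t" "t \<le> T"
  shows "((\<lambda>v. right_lim \<omega> x v) \<longlongrightarrow> 0) (at_right x)"
proof (rule tendsto_sandwich)
  have "right_lim \<omega> x v \<le> right_lim \<omega> x t - \<omega> v t" if v: "x < v" "v < t" for v
  proof (rule right_lim_le[OF assms(1)])
    fix r assume "x < r" "r < v"
    then show "\<omega> r v \<le> right_lim \<omega> x t - \<omega> v t"
      using control_superadditive[OF assms(1), of r v t] right_lim_ge[OF assms(1), of x r t] v assms
      by auto
  qed (use v assms in auto)
  then show "\<forall>\<^sub>F v in at_right x. right_lim \<omega> x v \<le> right_lim \<omega> x t - \<omega> v t"
    using eventually_at_right_real[OF assms(3)] by (auto elim!: eventually_mono)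
  show "\<forall>\<^sub>F v in at_right x. 0 \<le> right_lim \<omega> x v"
    using eventually_at_right_real[OF assms(3)]
    by eventually_elim (use assms in \<open>auto intro: right_lim_nonneg\<close>)
  show "((\<lambda>v. right_lim \<omega> x t - \<omega> v t) \<longlongrightarrow> 0) (at_right x)"
    using tendsto_diff[OF tendsto_const right_lim_tendsto[OF assms], of "right_lim \<omega> x t"] by simp
qed simp

section \<open>Limits along partitions\<close>

lemma RRS_converges_unique:
  assumes "RRS_converges \<Xi> s t K" "RRS_converges \<Xi> s t L"
  shows "K = L"
proof (rule ccontr)
  assume "K \<noteq> L"
  define \<epsilon> where "\<epsilon> = norm (K - L) / 2"
  have "\<epsilon> > 0" using \<open>K \<noteq> L\<close> by (simp add: \<epsilon>_def)
  then obtain P Q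
    where P: "is_partition s t P" "\<And>R. is_partition s t R \<Longrightarrow> P \<subseteq> R \<Longrightarrow> norm (riemann_sum \<Xi> R - K) < \<epsilon>"
      and Q: "is_partition s t Q" "\<And>R. is_partition s t R \<Longrightarrow> Q \<subseteq> R \<Longrightarrow> norm (riemann_sum \<Xi> R - L) < \<epsilon>"
    using assms unfolding RRS_converges_def by metis
  have "norm (K - L) < \<epsilon> + \<epsilon>"
    using P(2)[of "P \<union> Q"] Q(2)[of "P \<union> Q"] is_partition_Un[OF P(1) Q(1)]
    by (intro norm_diff_triangle_less[of K "riemann_sum \<Xi> (P \<union> Q)"]) (auto simp: norm_minus_commute)
  then show False by (simp add: \<epsilon>_def)
qed

text \<open>
  Partitions form a directed set, but the Cauchy condition supplies a sequence \<open>Q n\<close> of partitions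
  whose Riemann sums already determine the limit; any two of them are compared through their common
  refinement.
\<close>

lemma RRS_converges_if_Cauchy:
  fixes \<Xi> :: "real \<Rightarrow> real \<Rightarrow> 'e::banach"
  assumes "\<And>\<epsilon>. \<epsilon> > 0 \<Longrightarrow> \<exists>Q. is_partition s t Q \<and>
    (\<forall>P. is_partition s t P \<and> Q \<subseteq> P \<longrightarrow> norm (riemann_sum \<Xi> P - riemann_sum \<Xi> Q) < \<epsilon>)"
  shows "\<exists>K. RRS_converges \<Xi> s t K"
proof -
  have "\<exists>Q. is_partition s t Q \<and>
    (\<forall>P. is_partition s t P \<and> Q \<subseteq> P \<longrightarrow>
      norm (riemann_sum \<Xi> P - riemann_sum \<Xi> Q) < inverse (real (Suc n)))" for n
    by (rule assms) simp
  then obtain Q where Q: "\<And>n. is_partition s t (Q n)"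
    "\<And>n P. is_partition s t P \<Longrightarrow> Q n \<subseteq> P \<Longrightarrow>
      norm (riemann_sum \<Xi> P - riemann_sum \<Xi> (Q n)) < inverse (real (Suc n))"
    by metis
  define S where "S = (\<lambda>n. riemann_sum \<Xi> (Q n))"
  have S: "norm (S m - S n) < inverse (real (Suc m)) + inverse (real (Suc n))" for m n
  proof -
    have "norm (riemann_sum \<Xi> (Q m \<union> Q n) - S k) < inverse (real (Suc k))" if "k = m \<or> k = n" for k
      unfolding S_def using that is_partition_Un[OF Q(1) Q(1), of m n] by (intro Q(2)) auto
    then show ?thesis
      by (metis norm_diff_triangle_less norm_minus_commute)
  qed
  have "Cauchy S"
  proof (rule CauchyI)
    fix e :: real assume "e > 0"
    then obtain M where M: "inverse (real (Suc M)) < e / 2"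
      using reals_Archimedean half_gt_zero by blast
    have "norm (S m - S n) < e" if "M \<le> m" "M \<le> n" for m n
    proof -
      have "inverse (real (Suc m)) \<le> inverse (real (Suc M))"
        "inverse (real (Suc n)) \<le> inverse (real (Suc M))"
        using that by (auto intro!: le_imp_inverse_le)
      then show ?thesis using S[of m n] M by linarith
    qed
    then show "\<exists>M. \<forall>m\<ge>M. \<forall>n\<ge>M. norm (S m - S n) < e" by blast
  qed
  then obtain K where K: "S \<longlonglongrightarrow> K"
    using Cauchy_convergent convergent_def by blast
  have "RRS_converges \<Xi> s t K" unfolding RRS_converges_def
  proof (intro allI impI)
    fix e :: real assume "e > 0"
    then obtain M where M: "inverse (real (Suc M)) < e / 2"
      using reals_Archimedean half_gt_zero by blast
    obtain n0 where n0: "\<And>n. n \<ge> n0 \<Longrightarrow> norm (S n - K) < e / 2"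
      using LIMSEQ_D[OF K, of "e / 2"] \<open>e > 0\<close> by auto
    define n where "n = max M n0"
    have n: "inverse (real (Suc n)) \<le> inverse (real (Suc M))"
      by (auto intro!: le_imp_inverse_le simp: n_def)
    have "norm (riemann_sum \<Xi> (Q n) - K) < e / 2"
      using n0[of n] by (simp add: n_def S_def)
    note Qn = this
    have "norm (riemann_sum \<Xi> P - K) < e" if "is_partition s t P" "Q n \<subseteq> P" for P
    proof -
      have "norm (riemann_sum \<Xi> P - K) < inverse (real (Suc n)) + e / 2"
        using Q(2)[OF that] Qn by (rule norm_diff_triangle_less)
      then show ?thesis using n M by linarith
    qed
    then show "\<exists>P\<^sub>\<epsilon>. is_partition s t P\<^sub>\<epsilon> \<and>
        (\<forall>P. is_partition s t P \<and> P\<^sub>\<epsilon> \<subseteq> P \<longrightarrow> norm (riemann_sum \<Xi> P - K) < e)"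
      using Q(1) by blast
  qed
  then show ?thesis by blast
qed

text \<open>
  The points of \<open>Q\<close> are fixed while the gaps of \<open>P\<close> shrink, so inserting them one by one changes the
  sum by finitely many terms \<open>delta \<Xi> u x v\<close>, where \<open>u\<close> and \<open>v\<close> are close to \<open>x\<close>.
\<close>

lemma riemann_sum_add_points_small:
  assumes small: "\<And>x e. s < x \<Longrightarrow> x < t \<Longrightarrow> e > 0 \<Longrightarrow> \<exists>d>0. \<forall>u v. s \<le> u \<and> u < x \<and> x < v \<and> v \<le> t \<and>
      x - u < d \<and> v - x < d \<longrightarrow> norm (delta \<Xi> u x v) < e"
    and "finite Q" "Q \<subseteq> {s..t}" "e > 0"
  shows "\<exists>d>0. \<forall>P. is_partition s t P \<and> (\<forall>(u, v)\<in>partition_intervals P. v - u < d) \<longrightarrow>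
           norm (riemann_sum \<Xi> (P \<union> Q) - riemann_sum \<Xi> P) < e"
  using assms(2-4)
proof (induction arbitrary: e rule: finite_induct)
  case empty
  then show ?case by (intro exI[of _ 1]) auto
next
  case (insert x Q)
  obtain d1 where "d1 > 0" and d1: "\<And>P. is_partition s t P \<Longrightarrow>
      \<forall>(u, v)\<in>partition_intervals P. v - u < d1 \<Longrightarrow>
      norm (riemann_sum \<Xi> (P \<union> Q) - riemann_sum \<Xi> P) < e / 2"
    using insert.IH[of "e / 2"] insert.prems by auto
  show ?case
  proof (cases "x = s \<or> x = t")
    case True
    have "P \<union> insert x Q = P \<union> Q" if "is_partition s t P" for P
      using True that by (auto simp: is_partition_def)
    moreover have "e / 2 < e" using insert.prems by simp
    ultimately show ?thesis using \<open>d1 > 0\<close> d1 by (metis less_trans)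
  next
    case False
    then have "s < x" "x < t" using insert.prems by auto
    then obtain d2 where "d2 > 0" and d2: "\<And>u v. s \<le> u \<Longrightarrow> u < x \<Longrightarrow> x < v \<Longrightarrow> v \<le> t \<Longrightarrow>
      x - u < d2 \<Longrightarrow> v - x < d2 \<Longrightarrow> norm (delta \<Xi> u x v) < e / 2"
      using small[of x "e / 2"] insert.prems by auto
    have "norm (riemann_sum \<Xi> (P \<union> insert x Q) - riemann_sum \<Xi> P) < e"
      if P: "is_partition s t P" and gaps: "\<forall>(u, v)\<in>partition_intervals P. v - u < min d1 d2" for P
    proof (cases "x \<in> P \<union> Q")
      case True
      then have "P \<union> insert x Q = P \<union> Q" by auto
      moreover have "norm (riemann_sum \<Xi> (P \<union> Q) - riemann_sum \<Xi> P) < e / 2"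
        using gaps by (intro d1[OF P]) auto
      ultimately show ?thesis using insert.prems by simp
    next
      case False
      have PQ: "is_partition s t (P \<union> Q)"
        using P insert by (auto simp: is_partition_def)
      then obtain u v where uv: "(u, v) \<in> partition_intervals (P \<union> Q)" "u < x" "x < v"
        using enclosing_interval[of "P \<union> Q" x s t] False \<open>s < x\<close> \<open>x < t\<close>
        by (auto simp: is_partition_def)
      obtain u' v' where "(u', v') \<in> partition_intervals P" "u' \<le> u" "v \<le> v'"
        using coarser_interval[OF PQ P _ uv(1)] by blast
      then have "v - u < d2" using gaps by fastforce
      moreover have "s \<le> u" "v \<le> t"
        using uv PQ by (auto simp: is_partition_def partition_intervals_iff)
      ultimately have "norm (delta \<Xi> u x v) < e / 2"
        using uv by (intro d2) auto
      moreover have "norm (riemann_sum \<Xi> (P \<union> Q) - riemann_sum \<Xi> P) < e / 2"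
        using gaps by (intro d1[OF P]) auto
      moreover have "riemann_sum \<Xi> (P \<union> insert x Q) - riemann_sum \<Xi> P
          = (riemann_sum \<Xi> (P \<union> Q) - riemann_sum \<Xi> P) - delta \<Xi> u x v"
        using riemann_sum_insert[OF _ uv, of \<Xi>] PQ by (simp add: is_partition_def)
      then have "norm (riemann_sum \<Xi> (P \<union> insert x Q) - riemann_sum \<Xi> P)
          \<le> norm (riemann_sum \<Xi> (P \<union> Q) - riemann_sum \<Xi> P) + norm (delta \<Xi> u x v)"
        by (simp only: norm_triangle_ineq4)
      ultimately show ?thesis by linarith
    qed
    then show ?thesis using \<open>d1 > 0\<close> \<open>d2 > 0\<close> by (intro exI[of _ "min d1 d2"]) auto
  qed
qed

text \<open>
  A partition \<open>P\<close> of small mesh need not refine the partition \<open>Q\<close> that refinement convergence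
  provides, but \<open>P \<union> Q\<close> does, and passing from \<open>P\<close> to \<open>P \<union> Q\<close> costs little.
\<close>

lemma MRS_converges_if_RRS_converges:
  assumes K: "RRS_converges \<Xi> s t K"
    and small: "\<And>x e. s < x \<Longrightarrow> x < t \<Longrightarrow> e > 0 \<Longrightarrow> \<exists>d>0. \<forall>u v. s \<le> u \<and> u < x \<and> x < v \<and> v \<le> t \<and>
      x - u < d \<and> v - x < d \<longrightarrow> norm (delta \<Xi> u x v) < e"
  shows "MRS_converges \<Xi> s t K"
  unfolding MRS_converges_def
proof (intro allI impI)
  fix e :: real assume "e > 0"
  then obtain Q where Q: "is_partition s t Q"
    "\<And>P. is_partition s t P \<Longrightarrow> Q \<subseteq> P \<Longrightarrow> norm (riemann_sum \<Xi> P - K) < e / 2"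
    using K unfolding RRS_converges_def by (metis half_gt_zero)
  then have "finite Q" "Q \<subseteq> {s..t}" by (auto simp: is_partition_def)
  then obtain d where "d > 0" and d: "\<And>P. is_partition s t P \<Longrightarrow>
      \<forall>(u, v)\<in>partition_intervals P. v - u < d \<Longrightarrow>
      norm (riemann_sum \<Xi> (P \<union> Q) - riemann_sum \<Xi> P) < e / 2"
    using riemann_sum_add_points_small[OF small, where e = "e / 2" and Q = Q] \<open>e > 0\<close> by auto
  have "norm (riemann_sum \<Xi> P - K) < e" if P: "is_partition s t P" "mesh P < d" for P
  proof -
    have "v - u \<le> mesh P" if "(u, v) \<in> partition_intervals P" for u v
      unfolding mesh_def using P(1) that
      by (intro Max_ge) (auto simp: is_partition_def intro!: rev_image_eqI)
    then have "norm (riemann_sum \<Xi> (P \<union> Q) - riemann_sum \<Xi> P) < e / 2"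
      using P(2) by (intro d[OF P(1)]) force
    moreover have "norm (riemann_sum \<Xi> (P \<union> Q) - K) < e / 2"
      using Q(2)[of "P \<union> Q"] is_partition_Un[OF P(1) Q(1)] by auto
    ultimately show ?thesis
      using norm_diff_triangle_less[of "riemann_sum \<Xi> P" "riemann_sum \<Xi> (P \<union> Q)" "e / 2" K "e / 2"]
      by (simp add: norm_minus_commute)
  qed
  then show "\<exists>\<delta>>0. \<forall>P. is_partition s t P \<and> mesh P < \<delta> \<longrightarrow> norm (riemann_sum \<Xi> P - K) < e"
    using \<open>d > 0\<close> by blast
qed

section \<open>Removing one division point\<close>

text \<open>
  Hoelder's inequality with weights \<open>a\<close> and \<open>b\<close>, proved by normalising to \<open>A = B = 1\<close> and
  applying the weighted inequality between geometric and arithmetic mean to each term.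
\<close>

lemma sum_powr_mult_powr_le:
  fixes x y :: "'i \<Rightarrow> real"
  assumes "finite I" "\<And>i. i \<in> I \<Longrightarrow> 0 \<le> x i" "\<And>i. i \<in> I \<Longrightarrow> 0 \<le> y i"
    and "sum x I \<le> A" "sum y I \<le> B" "0 \<le> a" "0 \<le> b" "a + b = 1"
  shows "(\<Sum>i\<in>I. x i powr a * y i powr b) \<le> A powr a * B powr b"
proof -
  have A: "0 \<le> A" and B: "0 \<le> B" using assms by (meson order_trans sum_nonneg)+
  show ?thesis
  proof (cases "A = 0 \<or> B = 0")
    case True
    then have "\<forall>i\<in>I. x i powr a * y i powr b = 0"
      using assms by (metis mult_eq_0_iff order_antisym powr_0 sum_nonneg sum_nonneg_eq_0_iff)
    then have "(\<Sum>i\<in>I. x i powr a * y i powr b) = 0" by (intro sum.neutral)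
    then show ?thesis by simp
  next
    case False
    then have pos: "0 < A" "0 < B" using A B by auto
    have le: "(x i / A) powr a * (y i / B) powr b \<le> a * (x i / A) + b * (y i / B)" if "i \<in> I" for i
    proof (cases "x i = 0 \<or> y i = 0")
      case True
      then show ?thesis using assms that pos by auto
    next
      case False
      then show ?thesis using assms that pos
        by (intro Youngs_inequality_0) (auto simp: less_le)
    qed
    have "(\<Sum>i\<in>I. x i powr a * y i powr b)
        = A powr a * B powr b * (\<Sum>i\<in>I. (x i / A) powr a * (y i / B) powr b)"
      unfolding sum_distrib_left using assms pos
      by (intro sum.cong) (auto simp: powr_divide)
    also have "\<dots> \<le> A powr a * B powr b * (\<Sum>i\<in>I. a * (x i / A) + b * (y i / B))"
      using le by (intro mult_left_mono sum_mono) auto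
    also have "(\<Sum>i\<in>I. a * (x i / A) + b * (y i / B)) = a * (sum x I / A) + b * (sum y I / B)"
      by (simp add: sum.distrib sum_distrib_left sum_divide_distrib)
    also have "\<dots> \<le> a * 1 + b * 1"
      using assms pos by (intro add_mono mult_left_mono) auto
    finally show ?thesis using assms by (simp add: mult_left_mono)
  qed
qed

text \<open>
  The intervals to the left of points other than \<open>t\<close> all lie in \<open>[s,m]\<close>, where \<open>m < t\<close> is the last
  division point before \<open>t\<close>. This is why the final estimate sees only the left limit at \<open>t\<close>.
\<close>

lemma control_sum_left_neighbours_le:
  assumes \<omega>: "control T \<omega>" "0 \<le> s" "s < t" "t \<le> T" and P: "is_partition s t P"
    and R: "R \<subseteq> P - {t}" "\<And>x. x \<in> R \<Longrightarrow> (l x, x) \<in> partition_intervals P"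
  shows "(\<Sum>x\<in>R. \<omega> (l x) x) \<le> left_lim \<omega> s t"
proof -
  have fin: "finite (P - {t})" "s \<in> P - {t}" "P - {t} \<subseteq> {s..<t}"
    using P \<open>s < t\<close> by (auto simp: is_partition_def)
  define m where "m = Max (P - {t})"
  have m: "m \<in> P - {t}" using fin unfolding m_def by (intro Max_in) auto
  have le: "x \<le> m" if "x \<in> P - {t}" for x using fin that by (simp add: m_def)
  have "(\<Sum>x\<in>R. \<omega> (l x) x) = (\<Sum>(u, v)\<in>(\<lambda>x. (l x, x)) ` R. \<omega> u v)"
    by (subst sum.reindex) (auto intro: inj_onI)
  also have "\<dots> \<le> (\<Sum>(u, v)\<in>partition_intervals (P - {t}). \<omega> u v)"
  proof (rule sum_mono2)
    show "(\<lambda>x. (l x, x)) ` R \<subseteq> partition_intervals (P - {t})"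
      using R fin by (fastforce simp: partition_intervals_iff)
    show "0 \<le> (case i of (u, v) \<Rightarrow> \<omega> u v)"
      if "i \<in> partition_intervals (P - {t}) - (\<lambda>x. (l x, x)) ` R" for i
    proof -
      obtain u v where i: "i = (u, v)" by (cases i)
      then have "u \<in> P - {t}" "v \<in> P - {t}" "u < v"
        using that by (auto simp: partition_intervals_iff)
      then show ?thesis using fin \<omega> i by (auto intro!: control_nonneg[OF \<omega>(1)])
    qed
  qed (use fin in auto)
  also have "\<dots> \<le> \<omega> s m"
    using fin m le \<omega> by (intro control_sum_le[OF \<omega>(1)]) fastforce+
  also have "\<dots> \<le> left_lim \<omega> s t"
    using m fin \<omega> by (intro left_lim_ge) auto
  finally show ?thesis .
qed

lemma control_sum_right_neighbours_le:
  assumes \<omega>: "control T \<omega>" "0 \<le> s" "s < t" "t \<le> T" and P: "is_partition s t P"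
    and R: "R \<subseteq> P - {s}" "\<And>x. x \<in> R \<Longrightarrow> (x, r x) \<in> partition_intervals P"
  shows "(\<Sum>x\<in>R. \<omega> x (r x)) \<le> right_lim \<omega> s t"
proof -
  have fin: "finite (P - {s})" "t \<in> P - {s}" "P - {s} \<subseteq> {s<..t}"
    using P \<open>s < t\<close> by (auto simp: is_partition_def)
  define m where "m = Min (P - {s})"
  have m: "m \<in> P - {s}" using fin unfolding m_def by (intro Min_in) auto
  have le: "m \<le> x" if "x \<in> P - {s}" for x using fin that by (simp add: m_def)
  have "(\<Sum>x\<in>R. \<omega> x (r x)) = (\<Sum>(u, v)\<in>(\<lambda>x. (x, r x)) ` R. \<omega> u v)"
    by (subst sum.reindex) (auto intro: inj_onI)
  also have "\<dots> \<le> (\<Sum>(u, v)\<in>partition_intervals (P - {s}). \<omega> u v)"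
  proof (rule sum_mono2)
    show "(\<lambda>x. (x, r x)) ` R \<subseteq> partition_intervals (P - {s})"
      using R fin by (fastforce simp: partition_intervals_iff)
    show "0 \<le> (case i of (u, v) \<Rightarrow> \<omega> u v)"
      if "i \<in> partition_intervals (P - {s}) - (\<lambda>x. (x, r x)) ` R" for i
    proof -
      obtain u v where i: "i = (u, v)" by (cases i)
      then have "u \<in> P - {s}" "v \<in> P - {s}" "u < v"
        using that by (auto simp: partition_intervals_iff)
      then show ?thesis using fin \<omega> i by (auto intro!: control_nonneg[OF \<omega>(1)])
    qed
  qed (use fin in auto)
  also have "\<dots> \<le> \<omega> m t"
    using fin m le \<omega> by (intro control_sum_le[OF \<omega>(1)]) fastforce+
  also have "\<dots> \<le> right_lim \<omega> s t"
    using m fin \<omega> by (intro right_lim_ge) auto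
  finally show ?thesis .
qed

text \<open>
  The term with index \<open>k\<close>, multiplied by the prefactor, is \<open>(n / Suc k) powr \<theta>\<close>, the relative
  cost of removing a point while \<open>Suc k\<close> interior points are left; \<open>n\<close> counts the pairs of controls.
\<close>

definition sewing_const :: "nat \<Rightarrow> real \<Rightarrow> real" where
  "sewing_const n \<theta> = real n powr \<theta> * (\<Sum>k. real (Suc k) powr - \<theta>)"

lemma summable_Suc_powr: "1 < \<theta> \<Longrightarrow> summable (\<lambda>k. real (Suc k) powr - \<theta>)"
  using summable_real_powr_iff[of "- \<theta>"] summable_Suc_iff[of "\<lambda>k. real k powr - \<theta>"] by simp

lemma sewing_const_nonneg: "1 < \<theta> \<Longrightarrow> 0 \<le> sewing_const n \<theta>"
  unfolding sewing_const_def by (intro mult_nonneg_nonneg suminf_nonneg summable_Suc_powr) auto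

locale sewing =
  fixes T :: real and \<Xi> :: "real \<Rightarrow> real \<Rightarrow> 'e::banach" and J :: "'i set"
    and \<omega>1 \<omega>2 :: "'i \<Rightarrow> real \<Rightarrow> real \<Rightarrow> real" and \<alpha>1 \<alpha>2 :: "'i \<Rightarrow> real"
  assumes finite_J: "finite J" and nonempty_J: "J \<noteq> {}"
    and control1: "j \<in> J \<Longrightarrow> control T (\<omega>1 j)"
    and control2: "j \<in> J \<Longrightarrow> control T (\<omega>2 j)"
    and \<alpha>1_pos: "j \<in> J \<Longrightarrow> 0 < \<alpha>1 j"
    and \<alpha>2_pos: "j \<in> J \<Longrightarrow> 0 < \<alpha>2 j"
    and \<alpha>_sum: "j \<in> J \<Longrightarrow> 1 < \<alpha>1 j + \<alpha>2 j"
    and delta_le: "0 \<le> s \<Longrightarrow> s < u \<Longrightarrow> u < t \<Longrightarrow> t \<le> T \<Longrightarrow>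
      norm (delta \<Xi> s u t) \<le> (\<Sum>j\<in>J. \<omega>1 j s u powr \<alpha>1 j * \<omega>2 j u t powr \<alpha>2 j)"
begin

definition \<theta> :: real where "\<theta> = Min ((\<lambda>j. \<alpha>1 j + \<alpha>2 j) ` J)"

definition bound :: "real \<Rightarrow> real \<Rightarrow> real" where
  "bound s t = (\<Sum>j\<in>J. left_lim (\<omega>1 j) s t powr \<alpha>1 j * right_lim (\<omega>2 j) s t powr \<alpha>2 j)"

text \<open>
  The exponents divided by their sum, as Hoelder's inequality requires; raising to the power
  \<open>\<alpha>1 j + \<alpha>2 j\<close> recovers the original ones.
\<close>

definition \<beta>1 :: "'i \<Rightarrow> real" where "\<beta>1 j = \<alpha>1 j / (\<alpha>1 j + \<alpha>2 j)"

definition \<beta>2 :: "'i \<Rightarrow> real" where "\<beta>2 j = \<alpha>2 j / (\<alpha>1 j + \<alpha>2 j)"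

lemma \<beta>:
  assumes "j \<in> J"
  shows "0 < \<beta>1 j" "0 < \<beta>2 j" "\<beta>1 j + \<beta>2 j = 1"
  using \<alpha>1_pos[OF assms] \<alpha>2_pos[OF assms]
  by (auto simp: \<beta>1_def \<beta>2_def simp flip: add_divide_distrib)

lemma powr_\<beta>:
  assumes "j \<in> J" "0 \<le> x" "0 \<le> y"
  shows "(x powr \<beta>1 j * y powr \<beta>2 j) powr (\<alpha>1 j + \<alpha>2 j) = x powr \<alpha>1 j * y powr \<alpha>2 j"
  using \<alpha>_sum[OF assms(1)] by (simp add: powr_mult powr_powr \<beta>1_def \<beta>2_def)

lemma \<theta>_le: "j \<in> J \<Longrightarrow> \<theta> \<le> \<alpha>1 j + \<alpha>2 j"
  using finite_J by (simp add: \<theta>_def)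

lemma \<theta>_gt_1: "1 < \<theta>"
  using finite_J nonempty_J \<alpha>_sum by (simp add: \<theta>_def)

lemma bound_nonneg: "0 \<le> bound s t"
  by (auto simp: bound_def intro: sum_nonneg)

text \<open>
  The pigeonhole step. After normalisation, the costs \<open>a j x\<close> of removing the interior point \<open>x\<close> sum
  to at most \<open>1\<close> over \<open>x\<close> for each \<open>j\<close>, hence to at most \<open>card J\<close> over \<open>x\<close> and \<open>j\<close> together. One point
  therefore has \<open>a j x\<close> at most \<open>card J\<close> divided by the number of interior points, for every \<open>j\<close>
  simultaneously. Since \<open>a j x \<le> 1\<close>, the exponents \<open>\<alpha>1 j + \<alpha>2 j\<close> may all be lowered to \<open>\<theta>\<close>.
\<close>

lemma removable_point:
  assumes st: "0 \<le> s" "s < t" "t \<le> T" and P: "is_partition s t P" and "P - {s, t} \<noteq> {}"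
  obtains u x v where "x \<in> P - {s, t}" "(u, v) \<in> partition_intervals (P - {x})" "u < x" "x < v"
    "norm (delta \<Xi> u x v) \<le> (real (card J) / real (card (P - {s, t}))) powr \<theta> * bound s t"
proof -
  define R where "R = P - {s, t}"
  have fin: "finite P" "finite R" and "R \<noteq> {}" and PT: "P \<subseteq> {s..t}" "s \<in> P" "t \<in> P"
    using assms by (auto simp: is_partition_def R_def)
  have "\<forall>x\<in>R. \<exists>u v. (u, v) \<in> partition_intervals (P - {x}) \<and> u < x \<and> x < v"
  proof
    fix x assume "x \<in> R"
    then have "s < x" "x < t" using PT by (auto simp: R_def order_less_le)
    then show "\<exists>u v. (u, v) \<in> partition_intervals (P - {x}) \<and> u < x \<and> x < v"
      using enclosing_interval[of "P - {x}" x s t] fin PT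
      by (metis Diff_iff finite_Diff order_less_irrefl singletonD singletonI)
  qed
  then obtain l r where lr: "\<And>x. x \<in> R \<Longrightarrow> (l x, r x) \<in> partition_intervals (P - {x})"
    "\<And>x. x \<in> R \<Longrightarrow> l x < x" "\<And>x. x \<in> R \<Longrightarrow> x < r x"
    by metis
  have near: "(l x, x) \<in> partition_intervals P" "(x, r x) \<in> partition_intervals P"
    "s \<le> l x" "r x \<le> t" if "x \<in> R" for x
  proof -
    have "insert x (P - {x}) = P" using that by (auto simp: R_def)
    then show "(l x, x) \<in> partition_intervals P" "(x, r x) \<in> partition_intervals P"
      using partition_intervals_insert[OF lr[OF that]] by auto
    show "s \<le> l x" "r x \<le> t"
      using lr(1)[OF that] PT by (auto simp: partition_intervals_iff)
  qed
  define c where "c = (\<lambda>j x. \<omega>1 j (l x) x powr \<beta>1 j * \<omega>2 j x (r x) powr \<beta>2 j)"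
  define D where "D = (\<lambda>j. left_lim (\<omega>1 j) s t powr \<beta>1 j * right_lim (\<omega>2 j) s t powr \<beta>2 j)"
  have nonneg: "0 \<le> \<omega>1 j (l x) x" "0 \<le> \<omega>2 j x (r x)" if "j \<in> J" "x \<in> R" for j x
    using that lr(2,3)[OF that(2)] near(3,4)[OF that(2)] st
    by (auto intro!: control_nonneg[OF control1] control_nonneg[OF control2])
  have sum_c: "(\<Sum>x\<in>R. c j x) \<le> D j" if j: "j \<in> J" for j
    unfolding c_def D_def
  proof (rule sum_powr_mult_powr_le)
    show "(\<Sum>x\<in>R. \<omega>1 j (l x) x) \<le> left_lim (\<omega>1 j) s t"
      using near by (intro control_sum_left_neighbours_le[OF control1[OF j] st P]) (auto simp: R_def)
    show "(\<Sum>x\<in>R. \<omega>2 j x (r x)) \<le> right_lim (\<omega>2 j) s t"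
      using near by (intro control_sum_right_neighbours_le[OF control2[OF j] st P]) (auto simp: R_def)
  qed (use \<beta>[OF j] nonneg[OF j] fin in auto)
  have c_le: "c j x \<le> D j" if "j \<in> J" "x \<in> R" for j x
    using member_le_sum[OF that(2), of "c j"] sum_c[OF that(1)] fin by (force simp: c_def)
  have c_nonneg: "0 \<le> c j x" for j x by (simp add: c_def)
  \<comment> \<open>If \<open>D j = 0\<close>, then \<open>a j x = 0\<close> by the convention for division by zero, which is the right value
     because \<open>c j x \<le> D j\<close> then vanishes as well.\<close>
  define a where "a = (\<lambda>j x. c j x / D j)"
  have c_eq: "c j x = a j x * D j" if "j \<in> J" "x \<in> R" for j x
    using c_le[OF that] c_nonneg[of j x] by (auto simp: a_def)
  have a: "0 \<le> a j x" "a j x \<le> 1" if "j \<in> J" "x \<in> R" for j x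
    using c_le[OF that] c_nonneg[of j x] by (auto simp: a_def divide_le_eq_1)
  have sum_a: "(\<Sum>x\<in>R. a j x) \<le> 1" if "j \<in> J" for j
    using sum_c[OF that] by (auto simp: a_def divide_le_eq_1 D_def simp flip: sum_divide_distrib)
  have "\<exists>x\<in>R. (\<Sum>j\<in>J. a j x) \<le> real (card J) / real (card R)"
  proof (rule ccontr)
    assume "\<not> ?thesis"
    then have "(\<Sum>x\<in>R. real (card J) / real (card R)) < (\<Sum>x\<in>R. \<Sum>j\<in>J. a j x)"
      using fin \<open>R \<noteq> {}\<close> by (intro sum_strict_mono) auto
    also have "\<dots> = (\<Sum>j\<in>J. \<Sum>x\<in>R. a j x)" by (rule sum.swap)
    also have "\<dots> \<le> (\<Sum>j\<in>J. 1)" by (intro sum_mono sum_a)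
    finally show False using fin \<open>R \<noteq> {}\<close> by simp
  qed
  then obtain x where x: "x \<in> R" "(\<Sum>j\<in>J. a j x) \<le> real (card J) / real (card R)" by blast
  have "norm (delta \<Xi> (l x) x (r x))
      \<le> (\<Sum>j\<in>J. \<omega>1 j (l x) x powr \<alpha>1 j * \<omega>2 j x (r x) powr \<alpha>2 j)"
    using lr(2,3)[OF x(1)] near(3,4)[OF x(1)] st by (intro delta_le) auto
  also have "\<dots> \<le> (\<Sum>j\<in>J. (real (card J) / real (card R)) powr \<theta> *
      (left_lim (\<omega>1 j) s t powr \<alpha>1 j * right_lim (\<omega>2 j) s t powr \<alpha>2 j))"
  proof (rule sum_mono)
    fix j assume j: "j \<in> J"
    have "\<omega>1 j (l x) x powr \<alpha>1 j * \<omega>2 j x (r x) powr \<alpha>2 j = c j x powr (\<alpha>1 j + \<alpha>2 j)"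
      unfolding c_def using nonneg[OF j x(1)] by (simp add: powr_\<beta>[OF j])
    also have "\<dots> = a j x powr (\<alpha>1 j + \<alpha>2 j) * D j powr (\<alpha>1 j + \<alpha>2 j)"
      using c_eq[OF j x(1)] a[OF j x(1)] by (simp add: powr_mult D_def)
    also have "D j powr (\<alpha>1 j + \<alpha>2 j)
        = left_lim (\<omega>1 j) s t powr \<alpha>1 j * right_lim (\<omega>2 j) s t powr \<alpha>2 j"
      unfolding D_def using left_lim_nonneg[OF control1[OF j] st] right_lim_nonneg[OF control2[OF j] st]
      by (simp add: powr_\<beta>[OF j])
    also have "a j x powr (\<alpha>1 j + \<alpha>2 j) \<le> a j x powr \<theta>"
      using a[OF j x(1)] \<theta>_le[OF j] by (intro powr_mono') auto
    also have "a j x \<le> (\<Sum>j\<in>J. a j x)"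
      using a x(1) j finite_J by (intro member_le_sum) auto
    then have "a j x powr \<theta> \<le> (real (card J) / real (card R)) powr \<theta>"
      using x(2) a[OF j x(1)] \<theta>_gt_1 by (intro powr_mono2) auto
    finally show "\<omega>1 j (l x) x powr \<alpha>1 j * \<omega>2 j x (r x) powr \<alpha>2 j
        \<le> (real (card J) / real (card R)) powr \<theta> *
          (left_lim (\<omega>1 j) s t powr \<alpha>1 j * right_lim (\<omega>2 j) s t powr \<alpha>2 j)"
      by (simp add: mult_right_mono)
  qed
  also have "\<dots> = (real (card J) / real (card R)) powr \<theta> * bound s t"
    by (simp add: bound_def sum_distrib_left)
  finally show thesis
    using that x(1) lr[OF x(1)] unfolding R_def by blast
qed

lemma riemann_sum_minus_le_partial_sum:
  assumes st: "0 \<le> s" "s < t" "t \<le> T" and "is_partition s t P"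
  shows "norm (riemann_sum \<Xi> P - \<Xi> s t)
    \<le> real (card J) powr \<theta> * (\<Sum>k<card (P - {s, t}). real (Suc k) powr - \<theta>) * bound s t"
  using assms(4)
proof (induction "card (P - {s, t})" arbitrary: P)
  case 0
  then have "P = {s, t}" by (auto simp: is_partition_def)
  moreover have "partition_intervals {s, t} = {(s, t)}"
    using \<open>s < t\<close> by (auto simp: partition_intervals_def)
  ultimately show ?case by (simp add: riemann_sum_def)
next
  case (Suc n)
  then have "P - {s, t} \<noteq> {}" by (metis card.empty nat.distinct(1))
  then obtain u x v where x: "x \<in> P - {s, t}"
    and uv: "(u, v) \<in> partition_intervals (P - {x})" "u < x" "x < v"
    and le: "norm (delta \<Xi> u x v) \<le> (real (card J) / real (card (P - {s, t}))) powr \<theta> * bound s t"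
    using removable_point[OF st Suc.prems] by metis
  have fin: "finite P" using Suc.prems by (simp add: is_partition_def)
  have card: "card (P - {x} - {s, t}) = n"
  proof -
    have "P - {x} - {s, t} = (P - {s, t}) - {x}" by auto
    then show ?thesis using x Suc.hyps(2) fin by simp
  qed
  have P': "is_partition s t (P - {x})" using Suc.prems x by (auto simp: is_partition_def)
  have "riemann_sum \<Xi> P = riemann_sum \<Xi> (P - {x}) - delta \<Xi> u x v"
    using riemann_sum_insert[OF _ uv, of \<Xi>] fin x by (simp add: insert_absorb)
  then have "riemann_sum \<Xi> P - \<Xi> s t = (riemann_sum \<Xi> (P - {x}) - \<Xi> s t) - delta \<Xi> u x v"
    by simp
  then have "norm (riemann_sum \<Xi> P - \<Xi> s t)
      \<le> norm (riemann_sum \<Xi> (P - {x}) - \<Xi> s t) + norm (delta \<Xi> u x v)"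
    by (simp only: norm_triangle_ineq4)
  also have "norm (riemann_sum \<Xi> (P - {x}) - \<Xi> s t)
      \<le> real (card J) powr \<theta> * (\<Sum>k<n. real (Suc k) powr - \<theta>) * bound s t"
    using Suc.hyps(1)[of "P - {x}"] card P' by simp
  also have "norm (delta \<Xi> u x v) \<le> real (card J) powr \<theta> * real (Suc n) powr - \<theta> * bound s t"
    using le unfolding Suc.hyps(2)[symmetric] by (simp add: powr_divide powr_minus_divide)
  finally show ?case unfolding Suc.hyps(2)[symmetric] by (simp add: algebra_simps)
qed

text \<open>
  The maximal inequality behind the whole theorem: it is uniform over all partitions of \<open>[s,t]\<close>,
  because \<open>\<theta> > 1\<close> makes the removal costs summable.
\<close>

lemma riemann_sum_minus_le:
  assumes st: "0 \<le> s" "s < t" "t \<le> T" and "is_partition s t P"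
  shows "norm (riemann_sum \<Xi> P - \<Xi> s t) \<le> sewing_const (card J) \<theta> * bound s t"
proof -
  have "(\<Sum>k<card (P - {s, t}). real (Suc k) powr - \<theta>) \<le> (\<Sum>k. real (Suc k) powr - \<theta>)"
    by (intro sum_le_suminf summable_Suc_powr \<theta>_gt_1) auto
  then show ?thesis unfolding sewing_const_def
    by (intro order_trans[OF riemann_sum_minus_le_partial_sum[OF assms]])
      (auto intro!: mult_right_mono mult_left_mono bound_nonneg)
qed

section \<open>Convergence under refinement\<close>

text \<open>
  Dominated by the superadditive \<open>\<omega>1 j u v powr \<beta>1 j * \<omega>2 j u v powr \<beta>2 j\<close>, so its sums over
  partitions are bounded; its power with exponent \<open>\<alpha>1 j + \<alpha>2 j\<close> is the term of index \<open>j\<close> in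
  \<open>bound u v\<close>.
\<close>

definition \<phi> :: "'i \<Rightarrow> real \<Rightarrow> real \<Rightarrow> real" where
  "\<phi> j u v = left_lim (\<omega>1 j) u v powr \<beta>1 j * right_lim (\<omega>2 j) u v powr \<beta>2 j"

text \<open>
  It suffices that one factor vanishes while the other stays bounded: to the left of \<open>x\<close> it is the
  factor of \<open>\<omega>1\<close>, to the right of \<open>x\<close> that of \<open>\<omega>2\<close>.
\<close>

lemma \<phi>_tendsto_0_left:
  assumes "j \<in> J" "0 < x" "x \<le> T"
  shows "((\<lambda>u. \<phi> j u x) \<longlongrightarrow> 0) (at_left x)"
proof (rule tendsto_sandwich[where f = "\<lambda>_. 0"])
  have ev: "\<forall>\<^sub>F u in at_left x. 0 < u \<and> u < x"
    using eventually_at_left_real[OF assms(2)] by simp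
  show "\<forall>\<^sub>F u in at_left x. \<phi> j u x \<le> left_lim (\<omega>1 j) u x powr \<beta>1 j * \<omega>2 j 0 x powr \<beta>2 j"
    using ev
  proof eventually_elim
    case (elim u)
    have "right_lim (\<omega>2 j) u x \<le> \<omega>2 j u x"
      using elim assms by (intro right_lim_le_control[OF control2]) auto
    also have "\<dots> \<le> \<omega>2 j 0 x" using elim assms by (intro control_mono[OF control2]) auto
    finally show ?case unfolding \<phi>_def
      using elim assms \<beta>[OF assms(1)] right_lim_nonneg[OF control2[OF assms(1)], of u x]
      by (intro mult_left_mono powr_mono2) auto
  qed
  have "((\<lambda>u. left_lim (\<omega>1 j) u x powr \<beta>1 j) \<longlongrightarrow> 0) (at_left x)"
  proof (rule tendsto_zero_powrI[where b = "\<beta>1 j"])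
    show "((\<lambda>u. left_lim (\<omega>1 j) u x) \<longlongrightarrow> 0) (at_left x)"
      using assms by (intro left_lim_tendsto_0[OF control1]) auto
    show "\<forall>\<^sub>F u in at_left x. 0 \<le> left_lim (\<omega>1 j) u x"
      using ev by eventually_elim (use assms in \<open>auto intro!: left_lim_nonneg[OF control1]\<close>)
  qed (use \<beta>[OF assms(1)] in auto)
  then show "((\<lambda>u. left_lim (\<omega>1 j) u x powr \<beta>1 j * \<omega>2 j 0 x powr \<beta>2 j) \<longlongrightarrow> 0) (at_left x)"
    by (rule tendsto_mult_left_zero)
qed (auto simp: \<phi>_def)

lemma \<phi>_tendsto_0_right:
  assumes "j \<in> J" "0 \<le> x" "x < T"
  shows "((\<lambda>v. \<phi> j x v) \<longlongrightarrow> 0) (at_right x)"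
proof (rule tendsto_sandwich[where f = "\<lambda>_. 0"])
  have ev: "\<forall>\<^sub>F v in at_right x. x < v \<and> v < T"
    using eventually_at_right_real[OF assms(3)] by simp
  show "\<forall>\<^sub>F v in at_right x. \<phi> j x v \<le> \<omega>1 j x T powr \<beta>1 j * right_lim (\<omega>2 j) x v powr \<beta>2 j"
    using ev
  proof eventually_elim
    case (elim v)
    have "left_lim (\<omega>1 j) x v \<le> \<omega>1 j x v"
      using elim assms by (intro left_lim_le_control[OF control1]) auto
    also have "\<dots> \<le> \<omega>1 j x T" using elim assms by (intro control_mono[OF control1]) auto
    finally show ?case unfolding \<phi>_def
      using elim assms \<beta>[OF assms(1)] left_lim_nonneg[OF control1[OF assms(1)], of x v]
      by (intro mult_right_mono powr_mono2) auto
  qed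
  have "((\<lambda>v. right_lim (\<omega>2 j) x v powr \<beta>2 j) \<longlongrightarrow> 0) (at_right x)"
  proof (rule tendsto_zero_powrI[where b = "\<beta>2 j"])
    show "((\<lambda>v. right_lim (\<omega>2 j) x v) \<longlongrightarrow> 0) (at_right x)"
      using assms by (intro right_lim_tendsto_0[OF control2]) auto
    show "\<forall>\<^sub>F v in at_right x. 0 \<le> right_lim (\<omega>2 j) x v"
      using ev by eventually_elim (use assms in \<open>auto intro!: right_lim_nonneg[OF control2]\<close>)
  qed (use \<beta>[OF assms(1)] in auto)
  then show "((\<lambda>v. \<omega>1 j x T powr \<beta>1 j * right_lim (\<omega>2 j) x v powr \<beta>2 j) \<longlongrightarrow> 0) (at_right x)"
    by (rule tendsto_mult_right_zero)
qed (auto simp: \<phi>_def)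

lemma eventually_\<phi>_powr_le:
  assumes "\<And>j. j \<in> J \<Longrightarrow> ((\<lambda>u. f j u) \<longlongrightarrow> 0) F" "\<And>j u. 0 \<le> f j u" "0 < \<eta>"
  shows "\<forall>\<^sub>F u in F. \<forall>j\<in>J. f j u powr (\<alpha>1 j + \<alpha>2 j - 1) \<le> \<eta>"
proof (rule eventually_ball_finite[OF finite_J], rule ballI)
  fix j assume j: "j \<in> J"
  have "((\<lambda>u. f j u powr (\<alpha>1 j + \<alpha>2 j - 1)) \<longlongrightarrow> 0) F"
    using assms(1,2) j \<alpha>_sum[OF j]
    by (intro tendsto_zero_powrI[where b = "\<alpha>1 j + \<alpha>2 j - 1"]) auto
  then show "\<forall>\<^sub>F u in F. f j u powr (\<alpha>1 j + \<alpha>2 j - 1) \<le> \<eta>"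
    using order_tendstoD(2)[OF _ \<open>0 < \<eta>\<close>] by (fast elim: eventually_mono less_imp_le)
qed

lemma partition_\<phi>_small:
  assumes st: "0 \<le> s" "s \<le> t" "t \<le> T" and "0 < \<eta>"
  obtains Q where "is_partition s t Q"
    "\<forall>(u, v)\<in>partition_intervals Q. \<forall>j\<in>J. \<phi> j u v powr (\<alpha>1 j + \<alpha>2 j - 1) \<le> \<eta>"
proof (rule partition_into_good_intervals[OF \<open>s \<le> t\<close>,
    where G = "\<lambda>u v. \<forall>j\<in>J. \<phi> j u v powr (\<alpha>1 j + \<alpha>2 j - 1) \<le> \<eta>"])
  let ?G = "\<lambda>u v. \<forall>j\<in>J. \<phi> j u v powr (\<alpha>1 j + \<alpha>2 j - 1) \<le> \<eta>"
  fix x assume x: "s \<le> x" "x \<le> t"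
  have nonneg: "0 \<le> \<phi> j u v" for j u v by (simp add: \<phi>_def)
  have "\<exists>d>0. \<forall>u. s \<le> u \<and> u < x \<and> x - u < d \<longrightarrow> ?G u x"
  proof (cases "s < x")
    case True
    then have "\<forall>\<^sub>F u in at_left x. ?G u x"
      using st x nonneg \<open>0 < \<eta>\<close> by (intro eventually_\<phi>_powr_le \<phi>_tendsto_0_left) auto
    then obtain b where "b < x" "\<And>u. b < u \<Longrightarrow> u < x \<Longrightarrow> ?G u x"
      unfolding eventually_at_left_field by blast
    then show ?thesis by (intro exI[of _ "x - b"]) auto
  qed (auto intro: exI[of _ 1])
  then obtain d1 where d1: "d1 > 0" "\<And>u. s \<le> u \<Longrightarrow> u < x \<Longrightarrow> x - u < d1 \<Longrightarrow> ?G u x" by blast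
  have "\<exists>d>0. \<forall>v. x < v \<and> v \<le> t \<and> v - x < d \<longrightarrow> ?G x v"
  proof (cases "x < t")
    case True
    then have "\<forall>\<^sub>F v in at_right x. ?G x v"
      using st x nonneg \<open>0 < \<eta>\<close> by (intro eventually_\<phi>_powr_le \<phi>_tendsto_0_right) auto
    then obtain b where "x < b" "\<And>v. x < v \<Longrightarrow> v < b \<Longrightarrow> ?G x v"
      unfolding eventually_at_right_field by blast
    then show ?thesis by (intro exI[of _ "b - x"]) auto
  qed (auto intro: exI[of _ 1])
  then obtain d2 where d2: "d2 > 0" "\<And>v. x < v \<Longrightarrow> v \<le> t \<Longrightarrow> v - x < d2 \<Longrightarrow> ?G x v" by blast
  show "\<exists>d>0. (\<forall>u. s \<le> u \<and> u < x \<and> x - u < d \<longrightarrow> ?G u x) \<and>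
      (\<forall>v. x < v \<and> v \<le> t \<and> v - x < d \<longrightarrow> ?G x v)"
    using d1 d2 by (intro exI[of _ "min d1 d2"]) auto
qed (use that in blast)

lemma sum_\<phi>_le:
  assumes st: "0 \<le> s" "t \<le> T" and Q: "is_partition s t Q" and j: "j \<in> J"
  shows "(\<Sum>(u, v)\<in>partition_intervals Q. \<phi> j u v) \<le> \<omega>1 j s t powr \<beta>1 j * \<omega>2 j s t powr \<beta>2 j"
proof -
  have Q': "finite Q" "Q \<noteq> {}" "Q \<subseteq> {s..t}" using Q by (auto simp: is_partition_def)
  have uv: "0 \<le> u" "u < v" "u \<le> v" "v \<le> T" if "(u, v) \<in> partition_intervals Q" for u v
    using that Q' st by (auto simp: partition_intervals_iff)
  have "(\<Sum>(u, v)\<in>partition_intervals Q. \<phi> j u v)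
      \<le> (\<Sum>i\<in>partition_intervals Q. (\<lambda>(u, v). \<omega>1 j u v) i powr \<beta>1 j * (\<lambda>(u, v). \<omega>2 j u v) i powr \<beta>2 j)"
  proof (rule sum_mono, clarsimp)
    fix u v assume "(u, v) \<in> partition_intervals Q"
    note uv = uv[OF this]
    show "\<phi> j u v \<le> \<omega>1 j u v powr \<beta>1 j * \<omega>2 j u v powr \<beta>2 j"
      unfolding \<phi>_def using uv \<beta>[OF j]
      by (intro mult_mono powr_mono2 left_lim_le_control[OF control1[OF j]]
          right_lim_le_control[OF control2[OF j]] left_lim_nonneg[OF control1[OF j]]
          right_lim_nonneg[OF control2[OF j]]) auto
  qed
  also have "\<dots> \<le> \<omega>1 j s t powr \<beta>1 j * \<omega>2 j s t powr \<beta>2 j"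
  proof (rule sum_powr_mult_powr_le)
    show "(\<Sum>(u, v)\<in>partition_intervals Q. \<omega>1 j u v) \<le> \<omega>1 j s t"
      by (rule control_sum_le[OF control1[OF j] Q' st])
    show "(\<Sum>(u, v)\<in>partition_intervals Q. \<omega>2 j u v) \<le> \<omega>2 j s t"
      by (rule control_sum_le[OF control2[OF j] Q' st])
    show "0 \<le> (case i of (u, v) \<Rightarrow> \<omega>1 j u v)" if "i \<in> partition_intervals Q" for i
      using that uv by (cases i) (auto intro!: control_nonneg[OF control1[OF j]])
    show "0 \<le> (case i of (u, v) \<Rightarrow> \<omega>2 j u v)" if "i \<in> partition_intervals Q" for i
      using that uv by (cases i) (auto intro!: control_nonneg[OF control2[OF j]])
  qed (use Q' \<beta>[OF j] in auto)
  finally show ?thesis .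
qed

text \<open>
  On each interval of \<open>Q\<close> the maximal inequality bounds the error by \<open>C\<close> times the sum over \<open>j\<close> of
  \<open>\<phi> j u v powr (\<alpha>1 j + \<alpha>2 j)\<close>. One factor \<open>\<phi>\<close> is kept for summation, which costs the bounded amount \<open>M\<close>; the remaining power of \<open>\<phi>\<close> is at most
  \<open>\<eta>\<close> by the choice of \<open>Q\<close>.
\<close>

lemma riemann_sum_Cauchy:
  assumes st: "0 \<le> s" "s < t" "t \<le> T" and "0 < \<epsilon>"
  shows "\<exists>Q. is_partition s t Q \<and>
    (\<forall>P. is_partition s t P \<and> Q \<subseteq> P \<longrightarrow> norm (riemann_sum \<Xi> P - riemann_sum \<Xi> Q) < \<epsilon>)"
proof -
  define C where "C = sewing_const (card J) \<theta>"
  define M where "M = (\<Sum>j\<in>J. \<omega>1 j s t powr \<beta>1 j * \<omega>2 j s t powr \<beta>2 j)"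
  \<comment> \<open>The summand \<open>1\<close> keeps the denominator positive and the final inequality strict.\<close>
  define \<eta> where "\<eta> = \<epsilon> / (C * M + 1)"
  have C: "0 \<le> C" unfolding C_def by (rule sewing_const_nonneg[OF \<theta>_gt_1])
  have M: "0 \<le> M" unfolding M_def by (intro sum_nonneg) auto
  have "0 < C * M + 1" using C M by (simp add: add_nonneg_pos)
  then have \<eta>: "0 < \<eta>" "C * M * \<eta> < \<epsilon>" using \<open>0 < \<epsilon>\<close> C M
    by (auto simp: \<eta>_def field_simps)
  obtain Q where Q: "is_partition s t Q"
    and small: "\<forall>(u, v)\<in>partition_intervals Q. \<forall>j\<in>J. \<phi> j u v powr (\<alpha>1 j + \<alpha>2 j - 1) \<le> \<eta>"
    using partition_\<phi>_small[OF st(1) less_imp_le[OF st(2)] st(3) \<eta>(1)] .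
  have uv: "0 \<le> u" "u < v" "v \<le> T" if "(u, v) \<in> partition_intervals Q" for u v
    using that Q st by (auto simp: partition_intervals_iff is_partition_def)
  have bound: "bound u v \<le> \<eta> * (\<Sum>j\<in>J. \<phi> j u v)" if "(u, v) \<in> partition_intervals Q" for u v
    unfolding bound_def sum_distrib_left
  proof (rule sum_mono)
    fix j assume j: "j \<in> J"
    have "left_lim (\<omega>1 j) u v powr \<alpha>1 j * right_lim (\<omega>2 j) u v powr \<alpha>2 j
        = \<phi> j u v powr (\<alpha>1 j + \<alpha>2 j)"
      unfolding \<phi>_def using left_lim_nonneg[OF control1[OF j] uv[OF that]]
        right_lim_nonneg[OF control2[OF j] uv[OF that]] by (simp add: powr_\<beta>[OF j])
    also have "\<dots> = \<phi> j u v powr (\<alpha>1 j + \<alpha>2 j - 1) * \<phi> j u v"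
      by (cases "\<phi> j u v = 0") (auto simp: powr_diff \<phi>_def)
    also have "\<dots> \<le> \<eta> * \<phi> j u v"
      using small that j by (intro mult_right_mono) (auto simp: \<phi>_def)
    finally show "left_lim (\<omega>1 j) u v powr \<alpha>1 j * right_lim (\<omega>2 j) u v powr \<alpha>2 j \<le> \<eta> * \<phi> j u v" .
  qed
  \<comment> \<open>Every refinement is compared with \<open>Q\<close> interval by interval.\<close>
  have "norm (riemann_sum \<Xi> P - riemann_sum \<Xi> Q) < \<epsilon>" if P: "is_partition s t P" "Q \<subseteq> P" for P
  proof -
    have "riemann_sum \<Xi> P - riemann_sum \<Xi> Q
        = (\<Sum>(u, v)\<in>partition_intervals Q. riemann_sum \<Xi> (P \<inter> {u..v}) - \<Xi> u v)"
      unfolding riemann_sum_refinement[OF P(1) Q P(2)]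
      by (subst (2) riemann_sum_def) (simp add: sum_subtractf split_def)
    also have "norm \<dots> \<le> (\<Sum>(u, v)\<in>partition_intervals Q. C * (\<eta> * (\<Sum>j\<in>J. \<phi> j u v)))"
    proof (rule sum_norm_le, clarsimp)
      fix u v assume Quv: "(u, v) \<in> partition_intervals Q"
      have "norm (riemann_sum \<Xi> (P \<inter> {u..v}) - \<Xi> u v) \<le> C * bound u v"
        unfolding C_def
        by (rule riemann_sum_minus_le[OF uv[OF Quv] is_partition_restrict[OF P Quv]])
      also have "\<dots> \<le> C * (\<eta> * (\<Sum>j\<in>J. \<phi> j u v))"
        using bound[OF Quv] C by (rule mult_left_mono)
      finally show "norm (riemann_sum \<Xi> (P \<inter> {u..v}) - \<Xi> u v) \<le> C * (\<eta> * (\<Sum>j\<in>J. \<phi> j u v))" .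
    qed
    also have "\<dots> = C * (\<eta> * (\<Sum>j\<in>J. \<Sum>(u, v)\<in>partition_intervals Q. \<phi> j u v))"
      by (subst sum.swap) (simp add: sum_distrib_left split_def)
    also have "\<dots> \<le> C * (\<eta> * M)"
      unfolding M_def using C \<eta> st Q by (intro mult_left_mono sum_mono sum_\<phi>_le) auto
    finally show ?thesis using \<eta>(2) by (simp add: algebra_simps)
  qed
  with Q show ?thesis by blast
qed

lemma RRS_converges_sewing_integral:
  assumes "0 \<le> s" "s < t" "t \<le> T"
  shows "\<exists>!K. RRS_converges \<Xi> s t K" "RRS_converges \<Xi> s t (sewing_integral \<Xi> s t)"
proof -
  show *: "\<exists>!K. RRS_converges \<Xi> s t K"
    using RRS_converges_if_Cauchy[OF riemann_sum_Cauchy[OF assms]] RRS_converges_unique by blast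
  show "RRS_converges \<Xi> s t (sewing_integral \<Xi> s t)"
    unfolding sewing_integral_def by (rule theI'[OF *])
qed

lemma sewing_integral_minus_le:
  assumes "0 \<le> s" "s < t" "t \<le> T"
  shows "norm (sewing_integral \<Xi> s t - \<Xi> s t) \<le> sewing_const (card J) \<theta> * bound s t"
proof (rule field_le_epsilon)
  fix e :: real assume "e > 0"
  then obtain P where P: "is_partition s t P" "norm (riemann_sum \<Xi> P - sewing_integral \<Xi> s t) < e"
    using RRS_converges_sewing_integral(2)[OF assms] unfolding RRS_converges_def by blast
  then show "norm (sewing_integral \<Xi> s t - \<Xi> s t) \<le> sewing_const (card J) \<theta> * bound s t + e"
    using riemann_sum_minus_le[OF assms P(1)]
      norm_triangle_ineq[of "sewing_integral \<Xi> s t - riemann_sum \<Xi> P" "riemann_sum \<Xi> P - \<Xi> s t"]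
    by (simp add: norm_minus_commute)
qed

section \<open>Convergence as the mesh vanishes\<close>

text \<open>
  Left-continuity turns \<open>left_lim_tendsto_0\<close> into a statement about \<open>\<omega>1 j u x\<close> itself, one of the
  two factors in the bound on \<open>delta \<Xi> u x v\<close>; the other factor is bounded by its value on \<open>[0,T]\<close>.
\<close>

lemma delta_small_left_continuous:
  assumes cont: "\<And>j. j \<in> J \<Longrightarrow> left_continuous_snd T (\<omega>1 j)" and x: "0 < x" "x \<le> T" and "0 < e"
  shows "\<exists>d>0. \<forall>u v. 0 \<le> u \<and> u < x \<and> x < v \<and> v \<le> T \<and> x - u < d \<longrightarrow> norm (delta \<Xi> u x v) < e"
proof -
  have ev: "\<forall>\<^sub>F u in at_left x. 0 < u \<and> u < x"
    using eventually_at_left_real[OF x(1)] by simp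
  have "((\<lambda>u. \<Sum>j\<in>J. \<omega>1 j u x powr \<alpha>1 j * \<omega>2 j 0 T powr \<alpha>2 j) \<longlongrightarrow> 0) (at_left x)"
  proof (rule tendsto_null_sum, rule tendsto_mult_left_zero)
    fix j assume j: "j \<in> J"
    \<comment> \<open>The first argument is the one that varies, so left-continuity in the second argument is used
       at the fixed point \<open>x\<close>, once for each \<open>u\<close>.\<close>
    have "\<forall>\<^sub>F u in at_left x. left_lim (\<omega>1 j) u x = \<omega>1 j u x"
      using ev by eventually_elim (use cont[OF j] x in \<open>auto simp: left_continuous_snd_def\<close>)
    then have "((\<lambda>u. \<omega>1 j u x) \<longlongrightarrow> 0) (at_left x)"
      using left_lim_tendsto_0[OF control1[OF j], of 0 x] x by (simp cong: tendsto_cong)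
    moreover have "\<forall>\<^sub>F u in at_left x. 0 \<le> \<omega>1 j u x"
      using ev by eventually_elim (use x in \<open>auto intro!: control_nonneg[OF control1[OF j]]\<close>)
    ultimately show "((\<lambda>u. \<omega>1 j u x powr \<alpha>1 j) \<longlongrightarrow> 0) (at_left x)"
      using \<alpha>1_pos[OF j] by (intro tendsto_zero_powrI[where b = "\<alpha>1 j"]) auto
  qed
  then have "\<forall>\<^sub>F u in at_left x. (\<Sum>j\<in>J. \<omega>1 j u x powr \<alpha>1 j * \<omega>2 j 0 T powr \<alpha>2 j) < e"
    using \<open>0 < e\<close> by (rule order_tendstoD)
  then obtain b where b: "b < x"
    "\<And>u. b < u \<Longrightarrow> u < x \<Longrightarrow> (\<Sum>j\<in>J. \<omega>1 j u x powr \<alpha>1 j * \<omega>2 j 0 T powr \<alpha>2 j) < e"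
    unfolding eventually_at_left_field by blast
  have "norm (delta \<Xi> u x v) < e" if uv: "0 \<le> u" "u < x" "x < v" "v \<le> T" "x - u < x - b" for u v
  proof -
    have "norm (delta \<Xi> u x v) \<le> (\<Sum>j\<in>J. \<omega>1 j u x powr \<alpha>1 j * \<omega>2 j x v powr \<alpha>2 j)"
      using uv by (intro delta_le) auto
    also have "\<dots> \<le> (\<Sum>j\<in>J. \<omega>1 j u x powr \<alpha>1 j * \<omega>2 j 0 T powr \<alpha>2 j)"
      using uv by (intro sum_mono mult_left_mono powr_mono2 less_imp_le[OF \<alpha>2_pos]
        control_nonneg[OF control2] control_mono[OF control2]) auto
    also have "\<dots> < e" using uv by (intro b) auto
    finally show ?thesis .
  qed
  then show ?thesis using b(1) by (intro exI[of _ "x - b"]) auto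
qed

lemma delta_small_right_continuous:
  assumes cont: "\<And>j. j \<in> J \<Longrightarrow> right_continuous_fst T (\<omega>2 j)" and x: "0 \<le> x" "x < T" and "0 < e"
  shows "\<exists>d>0. \<forall>u v. 0 \<le> u \<and> u < x \<and> x < v \<and> v \<le> T \<and> v - x < d \<longrightarrow> norm (delta \<Xi> u x v) < e"
proof -
  have ev: "\<forall>\<^sub>F v in at_right x. x < v \<and> v < T"
    using eventually_at_right_real[OF x(2)] by simp
  have "((\<lambda>v. \<Sum>j\<in>J. \<omega>1 j 0 T powr \<alpha>1 j * \<omega>2 j x v powr \<alpha>2 j) \<longlongrightarrow> 0) (at_right x)"
  proof (rule tendsto_null_sum, rule tendsto_mult_right_zero)
    fix j assume j: "j \<in> J"
    have "\<forall>\<^sub>F v in at_right x. right_lim (\<omega>2 j) x v = \<omega>2 j x v"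
      using ev by eventually_elim (use cont[OF j] x in \<open>auto simp: right_continuous_fst_def\<close>)
    then have "((\<lambda>v. \<omega>2 j x v) \<longlongrightarrow> 0) (at_right x)"
      using right_lim_tendsto_0[OF control2[OF j], of x T] x by (simp cong: tendsto_cong)
    moreover have "\<forall>\<^sub>F v in at_right x. 0 \<le> \<omega>2 j x v"
      using ev by eventually_elim (use x in \<open>auto intro!: control_nonneg[OF control2[OF j]]\<close>)
    ultimately show "((\<lambda>v. \<omega>2 j x v powr \<alpha>2 j) \<longlongrightarrow> 0) (at_right x)"
      using \<alpha>2_pos[OF j] by (intro tendsto_zero_powrI[where b = "\<alpha>2 j"]) auto
  qed
  then have "\<forall>\<^sub>F v in at_right x. (\<Sum>j\<in>J. \<omega>1 j 0 T powr \<alpha>1 j * \<omega>2 j x v powr \<alpha>2 j) < e"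
    using \<open>0 < e\<close> by (rule order_tendstoD)
  then obtain b where b: "x < b"
    "\<And>v. x < v \<Longrightarrow> v < b \<Longrightarrow> (\<Sum>j\<in>J. \<omega>1 j 0 T powr \<alpha>1 j * \<omega>2 j x v powr \<alpha>2 j) < e"
    unfolding eventually_at_right_field by blast
  have "norm (delta \<Xi> u x v) < e" if uv: "0 \<le> u" "u < x" "x < v" "v \<le> T" "v - x < b - x" for u v
  proof -
    have "norm (delta \<Xi> u x v) \<le> (\<Sum>j\<in>J. \<omega>1 j u x powr \<alpha>1 j * \<omega>2 j x v powr \<alpha>2 j)"
      using uv by (intro delta_le) auto
    also have "\<dots> \<le> (\<Sum>j\<in>J. \<omega>1 j 0 T powr \<alpha>1 j * \<omega>2 j x v powr \<alpha>2 j)"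
      using uv by (intro sum_mono mult_right_mono powr_mono2 less_imp_le[OF \<alpha>1_pos]
        control_nonneg[OF control1] control_mono[OF control1]) auto
    also have "\<dots> < e" using uv by (intro b) auto
    finally show ?thesis .
  qed
  then show ?thesis using b(1) by (intro exI[of _ "b - x"]) auto
qed

lemma MRS_converges_sewing_integral:
  assumes "(\<forall>j\<in>J. left_continuous_snd T (\<omega>1 j)) \<or> (\<forall>j\<in>J. right_continuous_fst T (\<omega>2 j))"
    and st: "0 \<le> s" "s < t" "t \<le> T"
  shows "MRS_converges \<Xi> s t (sewing_integral \<Xi> s t)"
proof (rule MRS_converges_if_RRS_converges[OF RRS_converges_sewing_integral(2)[OF st]])
  fix x e :: real assume xe: "s < x" "x < t" "e > 0"
  have x: "0 < x" "x \<le> T" "0 \<le> x" "x < T" using xe st by auto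
  from assms(1) show "\<exists>d>0. \<forall>u v. s \<le> u \<and> u < x \<and> x < v \<and> v \<le> t \<and> x - u < d \<and> v - x < d
      \<longrightarrow> norm (delta \<Xi> u x v) < e"
  proof
    assume "\<forall>j\<in>J. left_continuous_snd T (\<omega>1 j)"
    then obtain d where "d > 0" "\<And>u v. 0 \<le> u \<Longrightarrow> u < x \<Longrightarrow> x < v \<Longrightarrow> v \<le> T \<Longrightarrow> x - u < d \<Longrightarrow>
        norm (delta \<Xi> u x v) < e"
      using delta_small_left_continuous[OF _ x(1,2) xe(3)] by blast
    then show ?thesis using st by (intro exI[of _ d]) auto
  next
    assume "\<forall>j\<in>J. right_continuous_fst T (\<omega>2 j)"
    then obtain d where "d > 0" "\<And>u v. 0 \<le> u \<Longrightarrow> u < x \<Longrightarrow> x < v \<Longrightarrow> v \<le> T \<Longrightarrow> v - x < d \<Longrightarrow>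
        norm (delta \<Xi> u x v) < e"
      using delta_small_right_continuous[OF _ x(3,4) xe(3)] by blast
    then show ?thesis using st by (intro exI[of _ d]) auto
  qed
qed

end

theorem theorem2p5:
  fixes N :: nat
  assumes "1 \<le> N"
  shows "\<exists>C :: real \<Rightarrow> real.
    \<forall>(T :: real) (\<Xi> :: real \<Rightarrow> real \<Rightarrow> 'e::banach)
      (\<omega>1 :: nat \<Rightarrow> real \<Rightarrow> real \<Rightarrow> real) (\<omega>2 :: nat \<Rightarrow> real \<Rightarrow> real \<Rightarrow> real)
      (\<alpha>1 :: nat \<Rightarrow> real) (\<alpha>2 :: nat \<Rightarrow> real).
      0 < T \<longrightarrow>
      (\<forall>j\<in>{1..N}. control T (\<omega>1 j) \<and> control T (\<omega>2 j) \<and>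
                  0 < \<alpha>1 j \<and> 0 < \<alpha>2 j \<and> 1 < \<alpha>1 j + \<alpha>2 j) \<longrightarrow>
      (\<forall>s u t. 0 \<le> s \<and> s < u \<and> u < t \<and> t \<le> T \<longrightarrow>
         norm (delta \<Xi> s u t) \<le> (\<Sum>j=1..N. \<omega>1 j s u powr \<alpha>1 j * \<omega>2 j u t powr \<alpha>2 j)) \<longrightarrow>
      (\<forall>s t. 0 \<le> s \<and> s < t \<and> t \<le> T \<longrightarrow>
         (\<exists>!K. RRS_converges \<Xi> s t K) \<and>
         norm (sewing_integral \<Xi> s t - \<Xi> s t) \<le>
           C (Min ((\<lambda>j. \<alpha>1 j + \<alpha>2 j) ` {1..N})) *
           (\<Sum>j=1..N. left_lim (\<omega>1 j) s t powr \<alpha>1 j * right_lim (\<omega>2 j) s t powr \<alpha>2 j)) \<and>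
      ((\<forall>j\<in>{1..N}. left_continuous_snd T (\<omega>1 j)) \<or>
       (\<forall>j\<in>{1..N}. right_continuous_fst T (\<omega>2 j)) \<longrightarrow>
         (\<forall>s t. 0 \<le> s \<and> s < t \<and> t \<le> T \<longrightarrow> MRS_converges \<Xi> s t (sewing_integral \<Xi> s t)))"
proof (rule exI[of _ "sewing_const N"], intro allI impI)
  fix T :: real and \<Xi> :: "real \<Rightarrow> real \<Rightarrow> 'e" and \<omega>1 \<omega>2 :: "nat \<Rightarrow> real \<Rightarrow> real \<Rightarrow> real"
    and \<alpha>1 \<alpha>2 :: "nat \<Rightarrow> real"
  assume "0 < T"
    and "\<forall>j\<in>{1..N}. control T (\<omega>1 j) \<and> control T (\<omega>2 j) \<and>
                  0 < \<alpha>1 j \<and> 0 < \<alpha>2 j \<and> 1 < \<alpha>1 j + \<alpha>2 j"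
    and "\<forall>s u t. 0 \<le> s \<and> s < u \<and> u < t \<and> t \<le> T \<longrightarrow>
         norm (delta \<Xi> s u t) \<le> (\<Sum>j=1..N. \<omega>1 j s u powr \<alpha>1 j * \<omega>2 j u t powr \<alpha>2 j)"
  then interpret sewing T \<Xi> "{1..N}" \<omega>1 \<omega>2 \<alpha>1 \<alpha>2
    using assms by unfold_locales auto
  show "(\<forall>s t. 0 \<le> s \<and> s < t \<and> t \<le> T \<longrightarrow>
         (\<exists>!K. RRS_converges \<Xi> s t K) \<and>
         norm (sewing_integral \<Xi> s t - \<Xi> s t) \<le>
           sewing_const N (Min ((\<lambda>j. \<alpha>1 j + \<alpha>2 j) ` {1..N})) *
           (\<Sum>j=1..N. left_lim (\<omega>1 j) s t powr \<alpha>1 j * right_lim (\<omega>2 j) s t powr \<alpha>2 j)) \<and>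
      ((\<forall>j\<in>{1..N}. left_continuous_snd T (\<omega>1 j)) \<or>
       (\<forall>j\<in>{1..N}. right_continuous_fst T (\<omega>2 j)) \<longrightarrow>
         (\<forall>s t. 0 \<le> s \<and> s < t \<and> t \<le> T \<longrightarrow> MRS_converges \<Xi> s t (sewing_integral \<Xi> s t)))"
    using RRS_converges_sewing_integral(1) sewing_integral_minus_le MRS_converges_sewing_integral
    unfolding \<theta>_def bound_def by simp
qed

end
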